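(* Let $(M,F=\alpha+\beta)$ be an $n$-dimensional Randers space with $\beta\neq 0$, and let $V\in\chi(M)$ be a projective vector field of $(M,F)$. Then the following statements are equivalent: (1) $V$ is C-projective; (2) $\mathcal{L}_{\hat V}\mathbf{\Sigma}=0$; (3) $\mathcal{L}_{\hat V}\mathbf{\Xi}=0$.
   Context: $M$ is a connected smooth $n$-dimensional manifold, $TM_0$ is the slit tangent bundle with standard local coordinates $(x^i,y^i)$, and $\chi(M)$ is the set of smooth vector fields on $M$. A Finsler metric is a function $F:TM\to[0,\infty)$, smooth on $TM_0$, positively 1-homogeneous in $y$, with $g_{ij}=\frac12[F^2]_{y^iy^j}$ positive definite on $TM_0$. A Randers metric is $F=\alpha+\beta$ with $\alpha=\sqrt{a_{ij}(x)y^iy^j}$ a Riemannian metric and $\beta=b_i(x)y^i$ a 1-form with $\|\beta_x\|_\alpha<1$ for all $x$. Spray and Berwald connection: $G^i=\frac14 g^{ih}\{y^k[F^2]_{x^ky^h}-[F^2]_{x^h}\}$, $G^i_{\ j}=\partial G^i/\partial y^j$, $G^i_{\ jk}=\partial G^i_{\ j}/\partial y^k$, $\frac{\delta}{\delta x^k}=\frac{\partial}{\partial x^k}-G^i_{\ k}\frac{\partial}{\partial y^i}$. The subscript $_{.i}$ denotes $\partial/\partial y^i$; the subscript $_{|k}$ denotes the Berwald horizontal covariant derivative, i.e. $f_{|k}=\frac{\delta f}{\delta x^k}$ for functions $f$ on $TM_0$ and $X_{i|k}=\frac{\delta X_i}{\delta x^k}-X_rG^r_{\ ik}$. S-curvature: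 $\mathbf S=G^m_{\ m}-y^m\frac{\partial}{\partial x^m}\ln\sigma_F$, where $\sigma_F(x)=\mathrm{Vol}(\mathbb B^n(1))/\mathrm{Vol}\{(y^i)\in\mathbb R^n: F(y^i\frac{\partial}{\partial x^i}|_x)<1\}$ (Busemann-Hausdorff volume density). Define $\mathbf\Xi=\Xi_i\,dx^i$ with $\Xi_i=y^m\mathbf S_{.i|m}-\mathbf S_{|i}$, and $\mathbf\Sigma=\Sigma_{ij}\,dx^i\otimes dx^j$ with $\Sigma_{ij}=\frac1{n+1}(\mathbf S_{.i|j}-\mathbf S_{.j|i})$. Lie derivatives: $\hat V=V^i\frac{\partial}{\partial x^i}+y^k\frac{\partial V^i}{\partial x^k}\frac{\partial}{\partial y^i}$ is the complete lift of $V$ to $TM$, and $\mathcal L_{\hat V}$ is the Lie derivative along $\hat V$. In components, $\mathcal L_{\hat V}\Xi_i=\hat V(\Xi_i)+\Xi_k\frac{\partial V^k}{\partial x^i}$ and $\mathcal L_{\hat V}\Sigma_{ij}=\hat V(\Sigma_{ij})+\Sigma_{kj}\frac{\partial V^k}{\partial x^i}+\Sigma_{ik}\frac{\partial V^k}{\partial x^j}$, and for the spray coefficients $\mathcal L_{\hat V}G^i=\hat V(G^i)-G^k\frac{\partial V^i}{\partial x^k}+\frac12y^jy^k\frac{\partial^2V^i}{\partial x^j\partial x^k}$. $V$ is projective if there is a function $P$ on $TM_0$ (the projective factor) with $\mathcal L_{\hat V}G^i=Py^i$. Writing $P_i=P_{.i}$, a projective vector field $V$ is C-projective if $P_{i|j}=P_{j|i}$.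 *)

theory Defs
  imports "HOL-Analysis.Analysis"
begin

section \<open>Smooth manifolds, tangent vectors, vector fields\<close>

text \<open>Iterated Frechet differentiability; intended for open \<open>S\<close> only.\<close>

primrec Ck_on :: "nat \<Rightarrow> 'a::real_normed_vector set \<Rightarrow> ('a \<Rightarrow> 'b::real_normed_vector) \<Rightarrow> bool" where
  "Ck_on 0 S f \<longleftrightarrow> continuous_on S f"
| "Ck_on (Suc k) S f \<longleftrightarrow>
     (\<forall>x\<in>S. f differentiable (at x)) \<and>
     (\<forall>v. Ck_on k S (\<lambda>x. frechet_derivative f (at x) v))"

definition smooth_on :: "'a::real_normed_vector set \<Rightarrow> ('a \<Rightarrow> 'b::real_normed_vector) \<Rightarrow> bool" where
  "smooth_on S f \<longleftrightarrow> (\<forall>k. Ck_on k S f)"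

text \<open>A chart is a pair of a domain and a coordinate map; only the values of the map on the
  domain matter.\<close>

type_synonym ('m, 'n) chart = "'m set \<times> ('m \<Rightarrow> real^'n)"

definition chart_image :: "('m, 'n::finite) chart \<Rightarrow> (real^'n) set" where
  "chart_image c = snd c ` fst c"

definition chart_inv :: "('m, 'n::finite) chart \<Rightarrow> real^'n \<Rightarrow> 'm" where
  "chart_inv c = inv_into (fst c) (snd c)"

definition transition :: "('m, 'n::finite) chart \<Rightarrow> ('m, 'n) chart \<Rightarrow> real^'n \<Rightarrow> real^'n" where
  "transition c d = snd d \<circ> chart_inv c"

definition smooth_atlas :: "'m topology \<Rightarrow> ('m, 'n::finite) chart set \<Rightarrow> bool" where
  "smooth_atlas M A \<longleftrightarrow>
     (\<Union>c\<in>A. fst c) = topspace M \<and>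
     (\<forall>c\<in>A. openin M (fst c) \<and> open (chart_image c) \<and>
        homeomorphic_map (subtopology M (fst c)) (top_of_set (chart_image c)) (snd c)) \<and>
     (\<forall>c\<in>A. \<forall>d\<in>A. smooth_on (snd c ` (fst c \<inter> fst d)) (transition c d))"

text \<open>The atlas is not required to be maximal. The dimension is \<open>CARD('n)\<close>.\<close>

definition smooth_manifold :: "'m topology \<Rightarrow> ('m, 'n::finite) chart set \<Rightarrow> bool" where
  "smooth_manifold M A \<longleftrightarrow> Hausdorff_space M \<and> second_countable M \<and> smooth_atlas M A"

text \<open>A tangent vector at \<open>p\<close> is the family of its coordinate vectors in all charts around \<open>p\<close>,
  related by the Jacobians of the transition maps (and \<open>0\<close> at the irrelevant charts, so that
  equality of tangent vectors is equality of families).\<close>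

type_synonym ('m, 'n) tvec = "('m, 'n) chart \<Rightarrow> real^'n"

definition tangent_space :: "('m, 'n::finite) chart set \<Rightarrow> 'm \<Rightarrow> ('m, 'n) tvec set" where
  "tangent_space A p = {v.
     (\<forall>c\<in>A. \<forall>d\<in>A. p \<in> fst c \<longrightarrow> p \<in> fst d \<longrightarrow>
        v d = frechet_derivative (transition c d) (at (snd c p)) (v c)) \<and>
     (\<forall>c. \<not> (c \<in> A \<and> p \<in> fst c) \<longrightarrow> v c = 0)}"

text \<open>The tangent vector \<open>\<Sum>\<^sub>i y\<^sup>i \<partial>/\<partial>x\<^sup>i\<close> at the point with coordinates \<open>x\<close> in the chart \<open>c\<close>.\<close>

definition coord_vec ::
    "('m, 'n::finite) chart set \<Rightarrow> ('m, 'n) chart \<Rightarrow> real^'n \<Rightarrow> real^'n \<Rightarrow> ('m, 'n) tvec" where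
  "coord_vec A c x y = (THE v. v \<in> tangent_space A (chart_inv c x) \<and> v c = y)"

text \<open>A function on \<open>TM\<close> is represented as \<open>f p v\<close> with \<open>p\<close> in \<open>M\<close> and \<open>v\<close> tangent at \<open>p\<close>; this is
  its expression in the standard local coordinates \<open>(x, y)\<close> of \<open>TM\<close>.\<close>

definition local_fun ::
    "('m, 'n::finite) chart set \<Rightarrow> ('m, 'n) chart \<Rightarrow> ('m \<Rightarrow> ('m, 'n) tvec \<Rightarrow> real) \<Rightarrow>
     real^'n \<Rightarrow> real^'n \<Rightarrow> real" where
  "local_fun A c f x y = f (chart_inv c x) (coord_vec A c x y)"

definition local_vf ::
    "('m, 'n::finite) chart \<Rightarrow> ('m \<Rightarrow> ('m, 'n) tvec) \<Rightarrow> real^'n \<Rightarrow> real^'n" where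
  "local_vf c V x = V (chart_inv c x) c"

definition smooth_vector_field ::
    "'m topology \<Rightarrow> ('m, 'n::finite) chart set \<Rightarrow> ('m \<Rightarrow> ('m, 'n) tvec) \<Rightarrow> bool" where
  "smooth_vector_field M A V \<longleftrightarrow>
     (\<forall>p\<in>topspace M. V p \<in> tangent_space A p) \<and>
     (\<forall>c\<in>A. smooth_on (chart_image c) (local_vf c V))"

section \<open>Randers metrics\<close>

definition riemannian_metric ::
    "('m, 'n::finite) chart set \<Rightarrow> ('m \<Rightarrow> ('m, 'n) tvec \<Rightarrow> ('m, 'n) tvec \<Rightarrow> real) \<Rightarrow> bool" where
  "riemannian_metric A a \<longleftrightarrow>
     (\<forall>c\<in>A. \<exists>g :: real^'n \<Rightarrow> real^'n^'n. smooth_on (chart_image c) g \<and>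
        (\<forall>x\<in>chart_image c. transpose (g x) = g x \<and> (\<forall>y. y \<noteq> 0 \<longrightarrow> y \<bullet> (g x *v y) > 0)) \<and>
        (\<forall>p\<in>fst c. \<forall>v\<in>tangent_space A p. \<forall>w\<in>tangent_space A p.
           a p v w = (\<Sum>i\<in>UNIV. \<Sum>j\<in>UNIV. g (snd c p) $ i $ j * v c $ i * w c $ j)))"

definition one_form ::
    "('m, 'n::finite) chart set \<Rightarrow> ('m \<Rightarrow> ('m, 'n) tvec \<Rightarrow> real) \<Rightarrow> bool" where
  "one_form A \<beta> \<longleftrightarrow>
     (\<forall>c\<in>A. \<exists>b :: real^'n \<Rightarrow> real^'n. smooth_on (chart_image c) b \<and>
        (\<forall>p\<in>fst c. \<forall>v\<in>tangent_space A p.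
           \<beta> p v = (\<Sum>i\<in>UNIV. b (snd c p) $ i * v c $ i)))"

definition one_form_norm ::
    "('m, 'n::finite) chart set \<Rightarrow> ('m \<Rightarrow> ('m, 'n) tvec \<Rightarrow> ('m, 'n) tvec \<Rightarrow> real) \<Rightarrow>
     ('m \<Rightarrow> ('m, 'n) tvec \<Rightarrow> real) \<Rightarrow> 'm \<Rightarrow> real" where
  "one_form_norm A a \<beta> p =
     (SUP v \<in> tangent_space A p - {\<lambda>_. 0}. \<bar>\<beta> p v\<bar> / sqrt (a p v v))"

definition randers_metric ::
    "'m topology \<Rightarrow> ('m, 'n::finite) chart set \<Rightarrow>
     ('m \<Rightarrow> ('m, 'n) tvec \<Rightarrow> ('m, 'n) tvec \<Rightarrow> real) \<Rightarrow> ('m \<Rightarrow> ('m, 'n) tvec \<Rightarrow> real) \<Rightarrow>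
     ('m \<Rightarrow> ('m, 'n) tvec \<Rightarrow> real) \<Rightarrow> bool" where
  "randers_metric M A a \<beta> F \<longleftrightarrow>
     riemannian_metric A a \<and> one_form A \<beta> \<and>
     (\<forall>p\<in>topspace M. one_form_norm A a \<beta> p < 1) \<and>
     (\<forall>p\<in>topspace M. \<forall>v\<in>tangent_space A p. F p v = sqrt (a p v v) + \<beta> p v)"

section \<open>Finsler geometry in standard local coordinates\<close>

text \<open>Here \<open>F\<close>, \<open>f\<close> and the components of tensors are functions of \<open>(x, y)\<close>; indices come first.\<close>

type_synonym 'n tmfun = "real^'n \<Rightarrow> real^'n \<Rightarrow> real"

definition pdx :: "'n::finite \<Rightarrow> 'n tmfun \<Rightarrow> 'n tmfun" where
  "pdx k f x y = deriv (\<lambda>t. f (x + t *\<^sub>R axis k 1) y) 0"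

definition pdy :: "'n::finite \<Rightarrow> 'n tmfun \<Rightarrow> 'n tmfun" where
  "pdy k f x y = deriv (\<lambda>t. f x (y + t *\<^sub>R axis k 1)) 0"

definition sq :: "'n::finite tmfun \<Rightarrow> 'n tmfun" where
  "sq F x y = (F x y)\<^sup>2"

definition fundamental_tensor :: "'n::finite tmfun \<Rightarrow> real^'n \<Rightarrow> real^'n \<Rightarrow> real^'n^'n" where
  "fundamental_tensor F x y = (\<chi> i j. 1/2 * pdy j (pdy i (sq F)) x y)"

definition spray :: "'n::finite tmfun \<Rightarrow> 'n \<Rightarrow> 'n tmfun" where
  "spray F i x y = 1/4 * (\<Sum>h\<in>UNIV. matrix_inv (fundamental_tensor F x y) $ i $ h *
     ((\<Sum>k\<in>UNIV. y $ k * pdy h (pdx k (sq F)) x y) - pdx h (sq F) x y))"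

text \<open>\<open>spray1 F i j\<close> is \<open>G\<^sup>i\<^sub>j\<close> and \<open>spray2 F i j k\<close> is \<open>G\<^sup>i\<^sub>j\<^sub>k\<close>.\<close>

definition spray1 :: "'n::finite tmfun \<Rightarrow> 'n \<Rightarrow> 'n \<Rightarrow> 'n tmfun" where
  "spray1 F i j = pdy j (spray F i)"

definition spray2 :: "'n::finite tmfun \<Rightarrow> 'n \<Rightarrow> 'n \<Rightarrow> 'n \<Rightarrow> 'n tmfun" where
  "spray2 F i j k = pdy k (spray1 F i j)"

text \<open>Berwald horizontal derivatives: \<open>f\<^sub>|\<^sub>k\<close> for functions and \<open>X\<^sub>i\<^sub>|\<^sub>k\<close> for covectors.\<close>

definition hder :: "'n::finite tmfun \<Rightarrow> 'n \<Rightarrow> 'n tmfun \<Rightarrow> 'n tmfun" where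
  "hder F k f x y = pdx k f x y - (\<Sum>i\<in>UNIV. spray1 F i k x y * pdy i f x y)"

definition hder_covec :: "'n::finite tmfun \<Rightarrow> ('n \<Rightarrow> 'n tmfun) \<Rightarrow> 'n \<Rightarrow> 'n \<Rightarrow> 'n tmfun" where
  "hder_covec F X i k x y = hder F k (X i) x y - (\<Sum>r\<in>UNIV. X r x y * spray2 F r i k x y)"

definition BH_density :: "'n::finite tmfun \<Rightarrow> real^'n \<Rightarrow> real" where
  "BH_density F x = measure lborel (ball (0::real^'n) 1) / measure lborel {y. F x y < 1}"

definition S_curvature :: "'n::finite tmfun \<Rightarrow> 'n tmfun" where
  "S_curvature F x y = (\<Sum>m\<in>UNIV. spray1 F m m x y) -
     (\<Sum>m\<in>UNIV. y $ m * pdx m (\<lambda>x _. ln (BH_density F x)) x y)"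

definition Xi_curvature :: "'n::finite tmfun \<Rightarrow> 'n \<Rightarrow> 'n tmfun" where
  "Xi_curvature F i x y =
     (\<Sum>m\<in>UNIV. y $ m * hder_covec F (\<lambda>r. pdy r (S_curvature F)) i m x y)
     - hder F i (S_curvature F) x y"

definition Sigma_curvature :: "'n::finite tmfun \<Rightarrow> 'n \<Rightarrow> 'n \<Rightarrow> 'n tmfun" where
  "Sigma_curvature F i j x y = 1 / (real CARD('n) + 1) *
     (hder_covec F (\<lambda>r. pdy r (S_curvature F)) i j x y
      - hder_covec F (\<lambda>r. pdy r (S_curvature F)) j i x y)"

text \<open>In the following \<open>W\<close> is the coordinate expression of a vector field on \<open>M\<close>.\<close>

definition vf_comp :: "(real^'n::finite \<Rightarrow> real^'n) \<Rightarrow> 'n \<Rightarrow> 'n tmfun" where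
  "vf_comp W i x y = W x $ i"

definition complete_lift :: "(real^'n::finite \<Rightarrow> real^'n) \<Rightarrow> 'n tmfun \<Rightarrow> 'n tmfun" where
  "complete_lift W f x y = (\<Sum>i\<in>UNIV. W x $ i * pdx i f x y) +
     (\<Sum>i\<in>UNIV. \<Sum>k\<in>UNIV. y $ k * pdx k (vf_comp W i) x y * pdy i f x y)"

definition Lie_covec ::
    "(real^'n::finite \<Rightarrow> real^'n) \<Rightarrow> ('n \<Rightarrow> 'n tmfun) \<Rightarrow> 'n \<Rightarrow> 'n tmfun" where
  "Lie_covec W X i x y = complete_lift W (X i) x y +
     (\<Sum>k\<in>UNIV. X k x y * pdx i (vf_comp W k) x y)"

definition Lie_tensor2 ::
    "(real^'n::finite \<Rightarrow> real^'n) \<Rightarrow> ('n \<Rightarrow> 'n \<Rightarrow> 'n tmfun) \<Rightarrow> 'n \<Rightarrow> 'n \<Rightarrow> 'n tmfun" where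
  "Lie_tensor2 W T i j x y = complete_lift W (T i j) x y +
     (\<Sum>k\<in>UNIV. T k j x y * pdx i (vf_comp W k) x y) +
     (\<Sum>k\<in>UNIV. T i k x y * pdx j (vf_comp W k) x y)"

definition Lie_spray ::
    "(real^'n::finite \<Rightarrow> real^'n) \<Rightarrow> ('n \<Rightarrow> 'n tmfun) \<Rightarrow> 'n \<Rightarrow> 'n tmfun" where
  "Lie_spray W G i x y = complete_lift W (G i) x y -
     (\<Sum>k\<in>UNIV. G k x y * pdx k (vf_comp W i) x y) +
     1/2 * (\<Sum>j\<in>UNIV. \<Sum>k\<in>UNIV. y $ j * y $ k * pdx k (pdx j (vf_comp W i)) x y)"

section \<open>Projective vector fields and vanishing Lie derivatives\<close>

text \<open>All identities below are on the slit tangent bundle, i.e. for \<open>y \<noteq> 0\<close>.\<close>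

definition projective_factor ::
    "('m, 'n::finite) chart set \<Rightarrow> ('m \<Rightarrow> ('m, 'n) tvec \<Rightarrow> real) \<Rightarrow> ('m \<Rightarrow> ('m, 'n) tvec) \<Rightarrow>
     ('m \<Rightarrow> ('m, 'n) tvec \<Rightarrow> real) \<Rightarrow> bool" where
  "projective_factor A F V P \<longleftrightarrow>
     (\<forall>c\<in>A. \<forall>x\<in>chart_image c. \<forall>y. y \<noteq> 0 \<longrightarrow>
        (\<forall>i. Lie_spray (local_vf c V) (spray (local_fun A c F)) i x y = local_fun A c P x y * y $ i))"

definition projective_vector_field ::
    "('m, 'n::finite) chart set \<Rightarrow> ('m \<Rightarrow> ('m, 'n) tvec \<Rightarrow> real) \<Rightarrow> ('m \<Rightarrow> ('m, 'n) tvec) \<Rightarrow> bool" where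
  "projective_vector_field A F V \<longleftrightarrow> (\<exists>P. projective_factor A F V P)"

text \<open>The projective factor is unique on the slit tangent bundle.\<close>

definition C_projective ::
    "('m, 'n::finite) chart set \<Rightarrow> ('m \<Rightarrow> ('m, 'n) tvec \<Rightarrow> real) \<Rightarrow> ('m \<Rightarrow> ('m, 'n) tvec) \<Rightarrow> bool" where
  "C_projective A F V \<longleftrightarrow>
     (\<exists>P. projective_factor A F V P \<and>
        (\<forall>c\<in>A. \<forall>x\<in>chart_image c. \<forall>y. y \<noteq> 0 \<longrightarrow>
          (\<forall>i j. hder_covec (local_fun A c F) (\<lambda>r. pdy r (local_fun A c P)) i j x y
               = hder_covec (local_fun A c F) (\<lambda>r. pdy r (local_fun A c P)) j i x y)))"

definition Lie_Sigma_vanishes ::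
    "('m, 'n::finite) chart set \<Rightarrow> ('m \<Rightarrow> ('m, 'n) tvec \<Rightarrow> real) \<Rightarrow> ('m \<Rightarrow> ('m, 'n) tvec) \<Rightarrow> bool" where
  "Lie_Sigma_vanishes A F V \<longleftrightarrow>
     (\<forall>c\<in>A. \<forall>x\<in>chart_image c. \<forall>y. y \<noteq> 0 \<longrightarrow>
        (\<forall>i j. Lie_tensor2 (local_vf c V) (Sigma_curvature (local_fun A c F)) i j x y = 0))"

definition Lie_Xi_vanishes ::
    "('m, 'n::finite) chart set \<Rightarrow> ('m \<Rightarrow> ('m, 'n) tvec \<Rightarrow> real) \<Rightarrow> ('m \<Rightarrow> ('m, 'n) tvec) \<Rightarrow> bool" where
  "Lie_Xi_vanishes A F V \<longleftrightarrow>
     (\<forall>c\<in>A. \<forall>x\<in>chart_image c. \<forall>y. y \<noteq> 0 \<longrightarrow>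
        (\<forall>i. Lie_covec (local_vf c V) (Xi_curvature (local_fun A c F)) i x y = 0))"

end

theory Submission
  imports Defs
begin

text \<open>
Work in one chart, write \<open>f\<^sub>i\<close> for the vertical derivative of \<open>f\<close> with respect to \<open>y\<^sup>i\<close>, and let
\<open>L\<close> be the derivation given by the complete lift of \<open>V\<close>.  Everything rests on the antisymmetric
tensor \<open>A\<^sub>i\<^sub>j(f) = f\<^sub>i\<^sub>|\<^sub>j - f\<^sub>j\<^sub>|\<^sub>i\<close> (\<open>hcurl\<close>), in which the term with \<open>G\<^sup>r\<^sub>i\<^sub>j\<close> cancels by symmetry.
It encodes all three conditions: \<open>V\<close> is C-projective iff \<open>A(P) = 0\<close>; \<open>\<Sigma>\<close> is \<open>A(S)/(n+1)\<close>; and by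
Euler's identities \<open>\<Xi>\<^sub>i = y\<^sup>m A\<^sub>i\<^sub>m(S)\<close>.

If the functions \<open>f\<^sub>i\<close> are homogeneous of degree 0 in \<open>y\<close>, the Lie derivative of \<open>A(f)\<close> along a
projective field is \<open>A(L f)\<close> (\<open>Lie_hcurl\<close>).  Indeed \<open>L\<close> fails to commute with
\<open>f \<mapsto> f\<^sub>i\<^sub>|\<^sub>j\<close> only through the Lie derivative \<open>P\<^sub>j y\<^sup>r + P \<delta>\<^sup>r\<^sub>j\<close> of \<open>G\<^sup>r\<^sub>j\<close>, and what this contributes is
\<open>P f\<^sub>i\<^sub>j\<close>, which is symmetric; the second derivatives of \<open>V\<close> contribute symmetric terms as well.
Taking the trace of the Lie derivative of \<open>G\<^sup>i\<^sub>j\<close> gives \<open>L S = (n+1) P - y\<^sup>k \<partial>\<^sub>k \<phi>\<close> with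
\<open>\<phi>\<close> the divergence of \<open>V\<close> for the Busemann-Hausdorff volume (\<open>lift_S\<close>); the last term is an exact
1-form on the base, so \<open>A\<close> kills it.  Hence the Lie derivative of \<open>\<Sigma>\<close> equals \<open>A(P)\<close>
pointwise (\<open>Lie_Sigma\<close>), and that of \<open>\<Xi>\<^sub>i\<close> equals \<open>(n+1) y\<^sup>m A\<^sub>i\<^sub>m(P)\<close> (\<open>Lie_Xi\<close>).

So the first two conditions are the same condition and imply the third.  For the converse, homogeneity gives
\<open>y\<^sup>m A\<^sub>i\<^sub>m(P) = y\<^sup>m \<partial>\<^sub>m P\<^sub>i - 2 G\<^sup>r P\<^sub>i\<^sub>r - \<partial>\<^sub>i P\<close>; differentiating this with respect to \<open>y\<^sup>j\<close> and
antisymmetrizing in \<open>i, j\<close> leaves \<open>2 A\<^sub>i\<^sub>j(P)\<close>, so if the contraction vanishes identically, then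
\<open>A(P)\<close> does (\<open>hcurl_zero_of_contraction_zero\<close>).

This calculus needs a smooth spray and a smooth volume density; for the Randers metric
\<open>F = \<alpha> + \<beta>\<close> both are checked by hand.  The spray is smooth because the fundamental tensor is
nondegenerate, by the equality case of the Cauchy-Schwarz inequality.  The density is smooth because the
unit ball of \<open>F\<close> at a point is the ellipsoid \<open>y \<bullet> (g - b b\<^sup>T) y + 2 b \<bullet> y < 1\<close>, whose volume is an explicit
algebraic function of \<open>g\<close> and \<open>b\<close>.
\<close>

section \<open>Closure properties of smooth functions\<close>

text \<open>On an open set the predicate depends only on the values of the function there, although the iterated
derivatives in its definition are taken of the total function.  This is what makes the following
inductions work: each closure property reduces to the one for the formula of the derivative.\<close>

lemma Ck_on_cong:
  assumes "open S" "\<And>x. x \<in> S \<Longrightarrow> f x = g x" "Ck_on k S f"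
  shows "Ck_on k S g"
  using assms(2,3)
proof (induction k arbitrary: f g)
  case 0
  have "continuous_on S f = continuous_on S g"
    by (rule continuous_on_cong) (use 0 in auto)
  with 0 show ?case by simp
next
  case (Suc k)
  have D: "(g has_derivative frechet_derivative f (at x)) (at x)" if "x \<in> S" for x
    using Suc.prems that assms(1)
    by (metis Ck_on.simps(2) frechet_derivative_works has_derivative_transform_within_open)
  have eq: "frechet_derivative f (at x) = frechet_derivative g (at x)" if "x \<in> S" for x
    using D[OF that] by (rule frechet_derivative_at)
  have "g differentiable (at x)" if "x \<in> S" for x
    using D[OF that] by (auto simp: differentiable_def)
  moreover have "Ck_on k S (\<lambda>x. frechet_derivative g (at x) v)" for v
    using Suc.IH[of "\<lambda>x. frechet_derivative f (at x) v" "\<lambda>x. frechet_derivative g (at x) v"] eq Suc.prems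
    by auto
  ultimately show ?case by auto
qed

lemma Ck_on_SucD: "Ck_on (Suc k) S f \<Longrightarrow> Ck_on k S f"
proof (induction k arbitrary: f)
  case 0
  then show ?case
    by (auto intro!: continuous_at_imp_continuous_on differentiable_imp_continuous_within)
qed auto

lemma Ck_on_SucI:
  assumes "open S" "\<And>x. x \<in> S \<Longrightarrow> (f has_derivative f' x) (at x)"
    and "\<And>v. Ck_on k S (\<lambda>x. f' x v)"
  shows "Ck_on (Suc k) S f"
proof -
  have eq: "f' x = frechet_derivative f (at x)" if "x \<in> S" for x
    using assms(2)[OF that] by (rule frechet_derivative_at)
  show ?thesis
    using assms eq Ck_on_cong[OF assms(1), of "\<lambda>x. f' x v" "\<lambda>x. frechet_derivative f (at x) v" k for v]
    by (auto simp: differentiable_def)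
qed

lemma Ck_on_const: "Ck_on k S (\<lambda>x. c)"
proof (induction k arbitrary: c)
  case (Suc k)
  then show ?case by simp
qed simp

lemma Ck_on_frechet:
  assumes "Ck_on (Suc k) S f" "x \<in> S"
  shows "(f has_derivative frechet_derivative f (at x)) (at x)"
  using assms frechet_derivative_works by auto

lemma Ck_on_add:
  assumes "open S" "Ck_on k S f" "Ck_on k S g"
  shows "Ck_on k S (\<lambda>x. f x + g x)"
  using assms(2,3)
proof (induction k arbitrary: f g)
  case (Suc k)
  show ?case
    by (rule Ck_on_SucI[where f'="\<lambda>x v. frechet_derivative f (at x) v + frechet_derivative g (at x) v"])
       (use assms(1) Suc in \<open>auto intro!: has_derivative_add Ck_on_frechet\<close>)
qed (auto intro: continuous_intros)

lemma Ck_on_mult: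
  fixes f g :: "'a::real_normed_vector \<Rightarrow> real"
  assumes "open S" "Ck_on k S f" "Ck_on k S g"
  shows "Ck_on k S (\<lambda>x. f x * g x)"
  using assms(2,3)
proof (induction k arbitrary: f g)
  case (Suc k)
  note D = Suc.prems[THEN Ck_on_SucD]
  show ?case
    by (rule Ck_on_SucI[where f'="\<lambda>x v. f x * frechet_derivative g (at x) v + frechet_derivative f (at x) v * g x"])
       (use assms(1) Suc D in \<open>auto intro!: has_derivative_mult Ck_on_frechet Ck_on_add\<close>)
qed (auto intro: continuous_intros)

text \<open>The derivative of a reciprocal is a product containing the same reciprocal, so the induction on the order
closes without a chain rule for compositions; square roots are treated in the same way.\<close>

lemma Ck_on_inverse:
  fixes f :: "'a::real_normed_vector \<Rightarrow> real"
  assumes "open S" "Ck_on k S f" "\<And>x. x \<in> S \<Longrightarrow> f x \<noteq> 0"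
  shows "Ck_on k S (\<lambda>x. inverse (f x))"
  using assms(2,3)
proof (induction k arbitrary: f)
  case (Suc k)
  have I: "Ck_on k S (\<lambda>x. inverse (f x))"
    using Suc.IH[OF Ck_on_SucD[OF Suc.prems(1)]] Suc.prems(2) by blast
  have D: "Ck_on k S (\<lambda>x. frechet_derivative f (at x) v)" for v
    using Suc.prems(1) by simp
  have N: "Ck_on k S (\<lambda>x. (-1) * (inverse (f x) * frechet_derivative f (at x) v * inverse (f x)))" for v
    by (intro Ck_on_mult Ck_on_const I D assms(1))
  show ?case
    by (rule Ck_on_SucI[where f'="\<lambda>x v. - (inverse (f x) * frechet_derivative f (at x) v * inverse (f x))"])
       (use assms(1) Suc.prems N in \<open>auto intro!: Deriv.has_derivative_inverse Ck_on_frechet\<close>)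
qed (auto intro!: continuous_intros)

lemma Ck_on_sqrt:
  fixes f :: "'a::real_normed_vector \<Rightarrow> real"
  assumes "open S" "Ck_on k S f" "\<And>x. x \<in> S \<Longrightarrow> f x > 0"
  shows "Ck_on k S (\<lambda>x. sqrt (f x))"
  using assms(2,3)
proof (induction k arbitrary: f)
  case (Suc k)
  have I: "Ck_on k S (\<lambda>x. inverse (sqrt (f x)))"
    using Suc.IH[OF Ck_on_SucD[OF Suc.prems(1)]] Suc.prems(2)
    by (intro Ck_on_inverse assms(1)) force+
  have D: "Ck_on k S (\<lambda>x. frechet_derivative f (at x) v)" for v
    using Suc.prems(1) by simp
  have N: "Ck_on k S (\<lambda>x. (1/2) * (frechet_derivative f (at x) v * inverse (sqrt (f x))))" for v
    by (intro Ck_on_mult Ck_on_const I D assms(1))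
  show ?case
  proof (rule Ck_on_SucI[where f'="\<lambda>x v. (1/2) * (frechet_derivative f (at x) v * inverse (sqrt (f x)))"])
    fix x assume x: "x \<in> S"
    show "((\<lambda>x. sqrt (f x)) has_derivative
            (\<lambda>v. 1/2 * (frechet_derivative f (at x) v * inverse (sqrt (f x))))) (at x)"
      by (rule has_derivative_eq_rhs, rule has_derivative_real_sqrt[OF _ Ck_on_frechet[OF Suc.prems(1) x]])
         (use Suc.prems(2)[OF x] in \<open>auto simp: field_simps\<close>)
  qed (use assms(1) N in auto)
qed (auto intro!: continuous_intros)

lemma Ck_on_ln:
  fixes f :: "'a::real_normed_vector \<Rightarrow> real"
  assumes "open S" "Ck_on k S f" "\<And>x. x \<in> S \<Longrightarrow> f x > 0"
  shows "Ck_on k S (\<lambda>x. ln (f x))"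
proof (cases k)
  case 0
  then show ?thesis using assms(2) by (auto intro!: continuous_intros dest: assms(3))
next
  case (Suc j)
  have I: "Ck_on j S (\<lambda>x. inverse (f x))"
    using assms(3) Ck_on_SucD[OF assms(2)[unfolded Suc]]
    by (intro Ck_on_inverse assms(1)) force+
  have D: "Ck_on j S (\<lambda>x. frechet_derivative f (at x) v)" for v
    using assms(2) Suc by simp
  have N: "Ck_on j S (\<lambda>x. frechet_derivative f (at x) v * inverse (f x))" for v
    by (intro Ck_on_mult I D assms(1))
  show ?thesis unfolding Suc
  proof (rule Ck_on_SucI[where f'="\<lambda>x v. frechet_derivative f (at x) v * inverse (f x)"])
    fix x assume x: "x \<in> S"
    show "((\<lambda>x. ln (f x)) has_derivative
            (\<lambda>v. frechet_derivative f (at x) v * inverse (f x))) (at x)"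
      using has_derivative_ln[OF assms(3)[OF x] Ck_on_frechet[OF assms(2)[unfolded Suc] x]] .
  qed (use assms(1) N in auto)
qed

lemma Ck_on_compose_linear:
  assumes "open S" "bounded_linear L" "Ck_on k S f" "open T" "L ` T \<subseteq> S"
  shows "Ck_on k T (\<lambda>z. f (L z))"
  using assms(3)
proof (induction k arbitrary: f)
  case 0
  then show ?case
    using assms linear_continuous_on[OF assms(2)]
    by (auto intro: continuous_on_compose2)
next
  case (Suc k)
  show ?case
  proof (rule Ck_on_SucI[where f'="\<lambda>z v. frechet_derivative f (at (L z)) (L v)"])
    fix z assume "z \<in> T"
    then have "L z \<in> S" using assms(5) by auto
    from Ck_on_frechet[OF Suc.prems this]
    show "((\<lambda>z. f (L z)) has_derivative (\<lambda>v. frechet_derivative f (at (L z)) (L v))) (at z)"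
      using diff_chain_at[OF bounded_linear_imp_has_derivative[OF assms(2)], of f _ z] by (simp add: o_def)
  qed (use assms(4) Suc in auto)
qed

lemma Ck_on_linear_compose:
  assumes "open S" "bounded_linear L" "Ck_on k S f"
  shows "Ck_on k S (\<lambda>z. L (f z))"
  using assms(3)
proof (induction k arbitrary: f)
  case 0
  then show ?case
    using assms linear_continuous_on[OF assms(2)]
    by (auto intro: continuous_on_compose2)
next
  case (Suc k)
  show ?case
    by (rule Ck_on_SucI[where f'="\<lambda>z v. L (frechet_derivative f (at z) v)"])
      (use assms(1) Suc in \<open>auto intro!: bounded_linear.has_derivative[OF assms(2)] Ck_on_frechet\<close>)
qed

lemma Ck_on_linear:
  assumes "open S" "bounded_linear L"
  shows "Ck_on k S L"
proof (cases k)
  case 0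
  then show ?thesis using assms linear_continuous_on by auto
next
  case (Suc j)
  show ?thesis unfolding Suc
    by (rule Ck_on_SucI[where f'="\<lambda>z v. L v"])
      (use assms in \<open>auto intro!: bounded_linear_imp_has_derivative Ck_on_const\<close>)
qed

lemma smooth_on_frechet:
  assumes "smooth_on S f"
  shows "smooth_on S (\<lambda>x. frechet_derivative f (at x) v)"
  using assms unfolding smooth_on_def by (metis Ck_on.simps(2))

lemma smooth_on_has_derivative:
  assumes "smooth_on S f" "x \<in> S"
  shows "(f has_derivative frechet_derivative f (at x)) (at x)"
  using assms Ck_on_frechet unfolding smooth_on_def by blast

lemma smooth_on_continuous: "smooth_on S f \<Longrightarrow> continuous_on S f"
  unfolding smooth_on_def by (metis Ck_on.simps(1))

lemma smooth_on_cong: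
  assumes "smooth_on S f" "open S" "\<And>x. x \<in> S \<Longrightarrow> f x = g x"
  shows "smooth_on S g"
  using assms unfolding smooth_on_def by (blast intro: Ck_on_cong)

lemma smooth_on_const: "smooth_on S (\<lambda>x. c)"
  by (simp add: smooth_on_def Ck_on_const)

lemma smooth_on_sum:
  fixes f :: "'i \<Rightarrow> 'a::real_normed_vector \<Rightarrow> 'b::real_normed_vector"
  assumes "open S" "\<And>i. i \<in> I \<Longrightarrow> smooth_on S (f i)"
  shows "smooth_on S (\<lambda>x. \<Sum>i\<in>I. f i x)"
  using assms(2)
  by (induction I rule: infinite_finite_induct)
     (auto simp: smooth_on_def Ck_on_const intro!: Ck_on_add assms(1))

lemma smooth_on_prod:
  fixes f :: "'i \<Rightarrow> 'a::real_normed_vector \<Rightarrow> real"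
  assumes "open S" "\<And>i. i \<in> I \<Longrightarrow> smooth_on S (f i)"
  shows "smooth_on S (\<lambda>x. \<Prod>i\<in>I. f i x)"
  using assms(2)
  by (induction I rule: infinite_finite_induct)
     (auto simp: smooth_on_def Ck_on_const intro!: Ck_on_mult assms(1))

lemma smooth_on_add: "open S \<Longrightarrow> smooth_on S f \<Longrightarrow> smooth_on S g \<Longrightarrow> smooth_on S (\<lambda>x. f x + g x)"
  unfolding smooth_on_def by (blast intro: Ck_on_add)

lemma smooth_on_mult:
  fixes f g :: "'a::real_normed_vector \<Rightarrow> real"
  shows "open S \<Longrightarrow> smooth_on S f \<Longrightarrow> smooth_on S g \<Longrightarrow> smooth_on S (\<lambda>x. f x * g x)"
  unfolding smooth_on_def by (blast intro: Ck_on_mult)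

lemma smooth_on_divide:
  fixes f g :: "'a::real_normed_vector \<Rightarrow> real"
  assumes "open S" "smooth_on S f" "smooth_on S g" "\<And>x. x \<in> S \<Longrightarrow> g x \<noteq> 0"
  shows "smooth_on S (\<lambda>x. f x / g x)"
  unfolding divide_inverse
  using assms by (intro smooth_on_mult assms) (auto simp: smooth_on_def intro: Ck_on_inverse)

lemma smooth_on_sqrt:
  fixes f :: "'a::real_normed_vector \<Rightarrow> real"
  assumes "open S" "smooth_on S f" "\<And>x. x \<in> S \<Longrightarrow> f x > 0"
  shows "smooth_on S (\<lambda>x. sqrt (f x))"
  using assms by (auto simp: smooth_on_def intro: Ck_on_sqrt)

lemma smooth_on_ln:
  fixes f :: "'a::real_normed_vector \<Rightarrow> real"
  assumes "open S" "smooth_on S f" "\<And>x. x \<in> S \<Longrightarrow> f x > 0"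
  shows "smooth_on S (\<lambda>x. ln (f x))"
  using assms by (auto simp: smooth_on_def intro: Ck_on_ln)

lemma smooth_on_power:
  fixes f :: "'a::real_normed_vector \<Rightarrow> real"
  assumes "open S" "smooth_on S f"
  shows "smooth_on S (\<lambda>x. f x ^ k)"
  using smooth_on_prod[OF assms(1), of "{..<k}" "\<lambda>_. f"] assms(2) by simp

lemma smooth_on_vec_nth: "open S \<Longrightarrow> smooth_on S f \<Longrightarrow> smooth_on S (\<lambda>x. f x $ i)"
  using Ck_on_linear_compose[OF _ bounded_linear_vec_nth] unfolding smooth_on_def by blast

section \<open>Symmetry of second derivatives\<close>

text \<open>The mixed second difference of \<open>f\<close> over a parallelogram is \<open>h\<^sup>2\<close> times a mixed derivative at an
intermediate point: apply the mean value theorem once in each direction.\<close>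

lemma second_difference_mvt:
  fixes f :: "'a::real_normed_vector \<Rightarrow> real"
  assumes "smooth_on S f" "convex S" "h > 0"
    and in_S: "\<And>s t. 0 \<le> s \<Longrightarrow> s \<le> h \<Longrightarrow> 0 \<le> t \<Longrightarrow> t \<le> h \<Longrightarrow> z + s *\<^sub>R u + t *\<^sub>R v \<in> S"
  shows "\<exists>s t. 0 \<le> s \<and> s \<le> h \<and> 0 \<le> t \<and> t \<le> h \<and>
    f (z + h *\<^sub>R u + h *\<^sub>R v) - f (z + h *\<^sub>R u) - f (z + h *\<^sub>R v) + f z
      = h * h * frechet_derivative (\<lambda>x. frechet_derivative f (at x) u) (at (z + s *\<^sub>R u + t *\<^sub>R v)) v"
proof -
  have line: "((\<lambda>r. g (p + r *\<^sub>R d)) has_real_derivative frechet_derivative g (at (p + r *\<^sub>R d)) d) (at r)"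
    if "smooth_on S g" "p + r *\<^sub>R d \<in> S" for g :: "'a \<Rightarrow> real" and p d r
  proof -
    have g: "(g has_derivative frechet_derivative g (at (p + r *\<^sub>R d))) (at (p + r *\<^sub>R d))"
      using smooth_on_has_derivative[OF that] .
    have l: "((\<lambda>r. p + r *\<^sub>R d) has_derivative (\<lambda>h. h *\<^sub>R d)) (at r)"
      by (auto intro!: derivative_eq_intros)
    have "((\<lambda>r. g (p + r *\<^sub>R d)) has_derivative (\<lambda>h. frechet_derivative g (at (p + r *\<^sub>R d)) (h *\<^sub>R d))) (at r)"
      using diff_chain_at[OF l g] by (simp add: o_def)
    moreover have "linear (frechet_derivative g (at (p + r *\<^sub>R d)))"
      using g has_derivative_linear by blast
    ultimately show ?thesis
      by (simp add: has_field_derivative_def linear_cmul mult_commute_abs)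
  qed
  define g where "g s = f (z + s *\<^sub>R u + h *\<^sub>R v) - f (z + s *\<^sub>R u)" for s
  define fu where "fu = (\<lambda>x. frechet_derivative f (at x) u)"
  have fu: "smooth_on S fu" unfolding fu_def by (rule smooth_on_frechet[OF assms(1)])
  have g': "(g has_real_derivative fu (z + s *\<^sub>R u + h *\<^sub>R v) - fu (z + s *\<^sub>R u)) (at s)"
    if "0 \<le> s" "s \<le> h" for s
  proof -
    have 1: "z + h *\<^sub>R v + s *\<^sub>R u \<in> S" and 2: "z + s *\<^sub>R u \<in> S"
      using in_S[of s h] in_S[of s 0] that \<open>h > 0\<close> by (auto simp: algebra_simps)
    show ?thesis unfolding g_def fu_def
      using DERIV_diff[OF line[OF assms(1) 1] line[OF assms(1) 2]] by (simp add: algebra_simps)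
  qed
  obtain s where s: "0 < s" "s < h" "g h - g 0 = h * (fu (z + s *\<^sub>R u + h *\<^sub>R v) - fu (z + s *\<^sub>R u))"
    using MVT2[OF \<open>h > 0\<close>, of g "\<lambda>s. fu (z + s *\<^sub>R u + h *\<^sub>R v) - fu (z + s *\<^sub>R u)"] g' by auto
  have "((\<lambda>t. fu (z + s *\<^sub>R u + t *\<^sub>R v)) has_real_derivative
      frechet_derivative fu (at (z + s *\<^sub>R u + t *\<^sub>R v)) v) (at t)" if "0 \<le> t" "t \<le> h" for t
    using line[OF fu, of "z + s *\<^sub>R u" t v] in_S[of s t] that s by auto
  from MVT2[OF \<open>h > 0\<close>, of "\<lambda>t. fu (z + s *\<^sub>R u + t *\<^sub>R v)", OF this]
  obtain t where "0 < t" "t < h"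
    "fu (z + s *\<^sub>R u + h *\<^sub>R v) - fu (z + s *\<^sub>R u) = h * frechet_derivative fu (at (z + s *\<^sub>R u + t *\<^sub>R v)) v"
    by auto
  with s show ?thesis
    by (intro exI[of _ s] exI[of _ t]) (auto simp: g_def fu_def)
qed

text \<open>The second difference is symmetric in the two directions, so the two mixed derivatives agree at some
points arbitrarily close to \<open>z\<close>, hence at \<open>z\<close> by continuity.\<close>

lemma frechet_derivative_commute:
  fixes f :: "'a::real_normed_vector \<Rightarrow> real"
  assumes "smooth_on S f" "open S" "z \<in> S"
  shows "frechet_derivative (\<lambda>x. frechet_derivative f (at x) u) (at z) v
       = frechet_derivative (\<lambda>x. frechet_derivative f (at x) v) (at z) u" (is "?uv z = ?vu z")
proof (rule ccontr)
  assume ne: "?uv z \<noteq> ?vu z"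
  define e where "e = \<bar>?uv z - ?vu z\<bar> / 2"
  have e: "e > 0" using ne by (simp add: e_def)
  have "continuous (at z) ?uv" "continuous (at z) ?vu"
    using smooth_on_continuous[OF smooth_on_frechet[OF smooth_on_frechet[OF assms(1)]]] assms(2,3)
    by (auto simp: continuous_on_eq_continuous_at)
  then obtain d1 d2 where d: "d1 > 0" "\<And>x. dist x z < d1 \<Longrightarrow> dist (?uv x) (?uv z) < e"
      "d2 > 0" "\<And>x. dist x z < d2 \<Longrightarrow> dist (?vu x) (?vu z) < e"
    using e unfolding continuous_at_eps_delta by blast
  obtain d3 where d3: "d3 > 0" "ball z d3 \<subseteq> S" using assms(2,3) openE by blast
  define r where "r = min d3 (min d1 d2)"
  have r: "r > 0" using d d3 by (simp add: r_def)
  \<comment> \<open>The side length is chosen so that the whole parallelogram lies in the ball of radius \<open>r\<close>.\<close>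
  define h where "h = r / (2 * (norm u + norm v + 1))"
  have den: "norm u + norm v + 1 > 0" by (smt (verit) norm_ge_zero)
  have h: "h > 0" using r den by (simp add: h_def)
  have near: "dist (z + s *\<^sub>R u + t *\<^sub>R v) z < r"
    if "0 \<le> s" "s \<le> h" "0 \<le> t" "t \<le> h" for s t
  proof -
    have "dist (z + s *\<^sub>R u + t *\<^sub>R v) z = norm (s *\<^sub>R u + t *\<^sub>R v)" by (simp add: dist_norm)
    also have "\<dots> \<le> s * norm u + t * norm v"
      using norm_triangle_ineq[of "s *\<^sub>R u" "t *\<^sub>R v"] that by simp
    also have "\<dots> \<le> h * norm u + h * norm v" using that by (intro add_mono mult_right_mono) auto
    also have "\<dots> \<le> h * (norm u + norm v + 1)" using h by (simp add: algebra_simps)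
    also have "\<dots> = r / 2" using den unfolding h_def by (simp add: divide_simps)
    also have "\<dots> < r" using r by simp
    finally show ?thesis .
  qed
  have S: "smooth_on (ball z d3) f"
    using Ck_on_compose_linear[OF assms(2) bounded_linear_ident _ open_ball, of _ f z d3] assms(1) d3(2)
    by (simp add: smooth_on_def)
  have in_S: "z + s *\<^sub>R u + t *\<^sub>R v \<in> ball z d3" "z + s *\<^sub>R v + t *\<^sub>R u \<in> ball z d3"
    if "0 \<le> s" "s \<le> h" "0 \<le> t" "t \<le> h" for s t
    using near[OF that] near[OF that(3,4,1,2)] by (auto simp: r_def dist_commute add_ac)
  obtain s t where 1: "0 \<le> s" "s \<le> h" "0 \<le> t" "t \<le> h"
    "f (z + h *\<^sub>R u + h *\<^sub>R v) - f (z + h *\<^sub>R u) - f (z + h *\<^sub>R v) + f z = h * h * ?uv (z + s *\<^sub>R u + t *\<^sub>R v)"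
    using second_difference_mvt[OF S convex_ball h, of z u v] in_S(1) by blast
  obtain s' t' where 2: "0 \<le> s'" "s' \<le> h" "0 \<le> t'" "t' \<le> h"
    "f (z + h *\<^sub>R v + h *\<^sub>R u) - f (z + h *\<^sub>R v) - f (z + h *\<^sub>R u) + f z = h * h * ?vu (z + s' *\<^sub>R v + t' *\<^sub>R u)"
    using second_difference_mvt[OF S convex_ball h, of z v u] in_S(2) by blast
  have swap: "z + h *\<^sub>R v + h *\<^sub>R u = z + h *\<^sub>R u + h *\<^sub>R v" by simp
  have "h * h * ?uv (z + s *\<^sub>R u + t *\<^sub>R v) = h * h * ?vu (z + s' *\<^sub>R v + t' *\<^sub>R u)"
    using 1(5) 2(5)[unfolded swap] by linarith
  then have "?uv (z + s *\<^sub>R u + t *\<^sub>R v) = ?vu (z + t' *\<^sub>R u + s' *\<^sub>R v)"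
    using h by (simp add: add.commute add.left_commute)
  moreover have "dist (?uv (z + s *\<^sub>R u + t *\<^sub>R v)) (?uv z) < e"
    using d(2) near[OF 1(1-4)] by (simp add: r_def)
  moreover have "dist (?vu (z + t' *\<^sub>R u + s' *\<^sub>R v)) (?vu z) < e"
    using d(4) near[OF 2(3,4,1,2)] by (simp add: r_def)
  ultimately have "\<bar>?uv z - ?vu z\<bar> < 2 * e" by (simp add: dist_real_def)
  then show False by (simp add: e_def)
qed

section \<open>Partial derivatives on the slit tangent bundle\<close>

text \<open>Smoothness over an open set of base points, away from the zero section: Finsler functions are not smooth
at \<open>y = 0\<close>, so this is the domain on which all identities below are stated.\<close>

definition smooth_tm :: "(real^'n::finite) set \<Rightarrow> 'n tmfun \<Rightarrow> bool" where
  "smooth_tm U f \<longleftrightarrow> smooth_on (U \<times> - {0}) (\<lambda>z. f (fst z) (snd z))"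

text \<open>Pullbacks of functions on the base; they are the kernel of the vertical derivatives.\<close>

definition basic :: "'n::finite tmfun \<Rightarrow> bool" where
  "basic f \<longleftrightarrow> (\<forall>x y y'. f x y = f x y')"

lemma pdy_basic: "basic f \<Longrightarrow> pdy k f x y = 0"
proof -
  assume "basic f"
  then have "(\<lambda>t. f x (y + t *\<^sub>R axis k 1)) = (\<lambda>t. f x y)" by (auto simp: basic_def)
  then show ?thesis by (simp add: pdy_def)
qed

lemma basic_pdx: "basic f \<Longrightarrow> basic (pdx k f)"
proof -
  assume f: "basic f"
  have "pdx k f x y = pdx k f x y'" for x y y'
  proof -
    have "(\<lambda>t. f (x + t *\<^sub>R axis k 1) y) = (\<lambda>t. f (x + t *\<^sub>R axis k 1) y')"
      using f unfolding basic_def by blast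
    then show ?thesis by (simp add: pdx_def)
  qed
  then show ?thesis unfolding basic_def by blast
qed

lemma basic_fun [simp]: "basic (\<lambda>x y. h x)"
  by (simp add: basic_def)

lemma basic_vf_comp: "basic (vf_comp W i)"
  by (simp add: basic_def vf_comp_def)

locale coordinate_domain =
  fixes U :: "(real^'n::finite) set"
  assumes open_U: "open U"
begin

abbreviation sm :: "'n tmfun \<Rightarrow> bool" where "sm \<equiv> smooth_tm U"

lemma open_slit: "open (U \<times> (- {0::real^'n}))"
  by (intro open_Times open_U open_Compl closed_singleton)

text \<open>The partial derivatives of the coordinate calculus are one-dimensional limits; for smooth functions they are values of
the Frechet derivative of the uncurried function.  This is the bridge to the smoothness theory.\<close>

lemma pd_DERIV:
  assumes "sm f" "x \<in> U" "y \<noteq> 0"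
  shows "((\<lambda>t. f (x + t *\<^sub>R u) (y + t *\<^sub>R v)) has_real_derivative
    frechet_derivative (\<lambda>z. f (fst z) (snd z)) (at (x, y)) (u, v)) (at 0)"
proof -
  let ?f = "\<lambda>z. f (fst z) (snd z)"
  have f: "(?f has_derivative frechet_derivative ?f (at (x, y))) (at (x, y))"
    by (rule smooth_on_has_derivative) (use assms in \<open>auto simp: smooth_tm_def\<close>)
  then have f0: "(?f has_derivative frechet_derivative ?f (at (x, y))) (at (x + 0 *\<^sub>R u, y + 0 *\<^sub>R v))"
    by simp
  have l: "((\<lambda>t. (x + t *\<^sub>R u, y + t *\<^sub>R v)) has_derivative (\<lambda>h. h *\<^sub>R (u, v))) (at 0)"
    by (auto intro!: derivative_eq_intros)
  have "((\<lambda>t. f (x + t *\<^sub>R u) (y + t *\<^sub>R v)) has_derivative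
      (\<lambda>h. frechet_derivative ?f (at (x, y)) (h *\<^sub>R (u, v)))) (at 0)"
    using diff_chain_at[OF l f0] by (simp add: o_def)
  moreover have "frechet_derivative ?f (at (x, y)) (h *\<^sub>R (u, v))
      = frechet_derivative ?f (at (x, y)) (u, v) * h" for h
    by (simp only: linear_cmul[OF has_derivative_linear[OF f]] real_scaleR_def mult.commute)
  ultimately show ?thesis
    by (simp only: has_field_derivative_def)
qed

lemma pdx_frechet:
  assumes "sm f" "x \<in> U" "y \<noteq> 0"
  shows "pdx k f x y = frechet_derivative (\<lambda>z. f (fst z) (snd z)) (at (x, y)) (axis k 1, 0)"
  using DERIV_imp_deriv[OF pd_DERIV[OF assms, of "axis k 1" 0]] by (simp add: pdx_def)

lemma pdy_frechet:
  assumes "sm f" "x \<in> U" "y \<noteq> 0"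
  shows "pdy k f x y = frechet_derivative (\<lambda>z. f (fst z) (snd z)) (at (x, y)) (0, axis k 1)"
  using DERIV_imp_deriv[OF pd_DERIV[OF assms, of 0 "axis k 1"]] by (simp add: pdy_def)

lemma pdx_DERIV:
  assumes "sm f" "x \<in> U" "y \<noteq> 0"
  shows "((\<lambda>t. f (x + t *\<^sub>R axis k 1) y) has_real_derivative pdx k f x y) (at 0)"
  using pd_DERIV[OF assms, of "axis k 1" 0] pdx_frechet[OF assms] by simp

lemma pdy_DERIV:
  assumes "sm f" "x \<in> U" "y \<noteq> 0"
  shows "((\<lambda>t. f x (y + t *\<^sub>R axis k 1)) has_real_derivative pdy k f x y) (at 0)"
  using pd_DERIV[OF assms, of 0 "axis k 1"] pdy_frechet[OF assms] by simp

lemma sm_cong: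
  assumes "sm f" "\<And>x y. x \<in> U \<Longrightarrow> y \<noteq> 0 \<Longrightarrow> f x y = g x y"
  shows "sm g"
  unfolding smooth_tm_def
  by (rule smooth_on_cong[OF assms(1)[unfolded smooth_tm_def] open_slit]) (use assms(2) in \<open>simp add: mem_Times_iff\<close>)

lemma sm_pdx [simp]: "sm f \<Longrightarrow> sm (pdx k f)"
  unfolding smooth_tm_def
  by (rule smooth_on_cong[OF smooth_on_frechet[of _ _ "(axis k 1, 0)"] open_slit])
     (simp_all add: pdx_frechet smooth_tm_def mem_Times_iff)

lemma sm_pdy [simp]: "sm f \<Longrightarrow> sm (pdy k f)"
  unfolding smooth_tm_def
  by (rule smooth_on_cong[OF smooth_on_frechet[of _ _ "(0, axis k 1)"] open_slit])
     (simp_all add: pdy_frechet smooth_tm_def mem_Times_iff)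

lemma sm_const [simp]: "sm (\<lambda>x y. c)"
  by (simp add: smooth_tm_def smooth_on_const)

lemma sm_add [simp]: "sm f \<Longrightarrow> sm g \<Longrightarrow> sm (\<lambda>x y. f x y + g x y)"
  using open_slit by (auto simp: smooth_tm_def smooth_on_def intro: Ck_on_add)

lemma sm_mult [simp]: "sm f \<Longrightarrow> sm g \<Longrightarrow> sm (\<lambda>x y. f x y * g x y)"
  using open_slit by (auto simp: smooth_tm_def smooth_on_def intro: Ck_on_mult)

lemma sm_minus [simp]: "sm f \<Longrightarrow> sm (\<lambda>x y. - f x y)"
  using sm_mult[OF sm_const[of "-1"], of f] by simp

lemma sm_divide_const [simp]: "sm f \<Longrightarrow> sm (\<lambda>x y. f x y / c)"
  using sm_mult[OF _ sm_const[of "inverse c"], of f] by (simp add: divide_inverse)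

lemma sm_diff [simp]: "sm f \<Longrightarrow> sm g \<Longrightarrow> sm (\<lambda>x y. f x y - g x y)"
  using sm_add[OF _ sm_minus, of f g] by simp

lemma sm_sum [simp]: "(\<And>i. i \<in> I \<Longrightarrow> sm (f i)) \<Longrightarrow> sm (\<lambda>x y. \<Sum>i\<in>I. f i x y)"
  unfolding smooth_tm_def by (rule smooth_on_sum[OF open_slit])

lemma sm_inverse: "sm f \<Longrightarrow> (\<And>x y. x \<in> U \<Longrightarrow> y \<noteq> 0 \<Longrightarrow> f x y \<noteq> 0) \<Longrightarrow> sm (\<lambda>x y. inverse (f x y))"
  using Ck_on_inverse[OF open_slit, of _ "\<lambda>z. f (fst z) (snd z)"]
  by (simp add: smooth_tm_def smooth_on_def mem_Times_iff)

lemma sm_divide: "sm f \<Longrightarrow> sm g \<Longrightarrow> (\<And>x y. x \<in> U \<Longrightarrow> y \<noteq> 0 \<Longrightarrow> g x y \<noteq> 0) \<Longrightarrow> sm (\<lambda>x y. f x y / g x y)"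
  unfolding divide_inverse by (intro sm_mult sm_inverse) auto

lemma sm_sqrt: "sm f \<Longrightarrow> (\<And>x y. x \<in> U \<Longrightarrow> y \<noteq> 0 \<Longrightarrow> f x y > 0) \<Longrightarrow> sm (\<lambda>x y. sqrt (f x y))"
  using Ck_on_sqrt[OF open_slit, of _ "\<lambda>z. f (fst z) (snd z)"]
  by (simp add: smooth_tm_def smooth_on_def mem_Times_iff)

lemma sm_coord [simp]: "sm (\<lambda>x y. y $ i)"
  unfolding smooth_tm_def smooth_on_def
  by (intro allI Ck_on_linear open_slit bounded_linear_compose[OF bounded_linear_vec_nth bounded_linear_snd])

lemma sm_base:
  assumes "smooth_on U h"
  shows "sm (\<lambda>x y. h x)"
  using assms unfolding smooth_tm_def smooth_on_def
  by (auto intro!: Ck_on_compose_linear[OF open_U bounded_linear_fst] open_slit)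

lemma
  assumes "x \<in> U" "y \<noteq> 0"
  shows pdx_const [simp]: "pdx k (\<lambda>x y. c) x y = 0"
    and pdy_const [simp]: "pdy k (\<lambda>x y. c) x y = 0"
    and pdx_coord [simp]: "pdx k (\<lambda>x y. y $ i) x y = 0"
    and pdy_coord [simp]: "pdy k (\<lambda>x y. y $ i) x y = (if i = k then 1 else 0)"
proof -
  have "((\<lambda>t. (y + t *\<^sub>R axis k 1) $ i) has_real_derivative (if i = k then 1 else 0)) (at 0)"
    by (auto simp: axis_def intro!: derivative_eq_intros)
  then show "pdy k (\<lambda>x y. y $ i) x y = (if i = k then 1 else 0)"
    unfolding pdy_def by (rule DERIV_imp_deriv)
qed (auto simp: pdx_def pdy_def)

context
  fixes x y :: "real^'n"
  assumes xy: "x \<in> U" "y \<noteq> 0"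
begin

lemma
  assumes "sm f" "sm g"
  shows pdx_add: "pdx k (\<lambda>x y. f x y + g x y) x y = pdx k f x y + pdx k g x y"
    and pdy_add: "pdy k (\<lambda>x y. f x y + g x y) x y = pdy k f x y + pdy k g x y"
    and pdx_diff: "pdx k (\<lambda>x y. f x y - g x y) x y = pdx k f x y - pdx k g x y"
    and pdy_diff: "pdy k (\<lambda>x y. f x y - g x y) x y = pdy k f x y - pdy k g x y"
    and pdx_mult: "pdx k (\<lambda>x y. f x y * g x y) x y = pdx k f x y * g x y + f x y * pdx k g x y"
    and pdy_mult: "pdy k (\<lambda>x y. f x y * g x y) x y = pdy k f x y * g x y + f x y * pdy k g x y"
proof -
  note X = pdx_DERIV[OF assms(1) xy, of k] pdx_DERIV[OF assms(2) xy, of k]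
  note Y = pdy_DERIV[OF assms(1) xy, of k] pdy_DERIV[OF assms(2) xy, of k]
  show "pdx k (\<lambda>x y. f x y + g x y) x y = pdx k f x y + pdx k g x y"
    using DERIV_imp_deriv[OF DERIV_add[OF X]] by (simp add: pdx_def)
  show "pdy k (\<lambda>x y. f x y + g x y) x y = pdy k f x y + pdy k g x y"
    using DERIV_imp_deriv[OF DERIV_add[OF Y]] by (simp add: pdy_def)
  show "pdx k (\<lambda>x y. f x y - g x y) x y = pdx k f x y - pdx k g x y"
    using DERIV_imp_deriv[OF DERIV_diff[OF X]] by (simp add: pdx_def)
  show "pdy k (\<lambda>x y. f x y - g x y) x y = pdy k f x y - pdy k g x y"
    using DERIV_imp_deriv[OF DERIV_diff[OF Y]] by (simp add: pdy_def)
  show "pdx k (\<lambda>x y. f x y * g x y) x y = pdx k f x y * g x y + f x y * pdx k g x y"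
    using DERIV_imp_deriv[OF DERIV_mult[OF X]] by (simp add: pdx_def mult.commute)
  show "pdy k (\<lambda>x y. f x y * g x y) x y = pdy k f x y * g x y + f x y * pdy k g x y"
    using DERIV_imp_deriv[OF DERIV_mult[OF Y]] by (simp add: pdy_def mult.commute)
qed

lemma
  assumes "\<And>i. i \<in> I \<Longrightarrow> sm (f i)"
  shows pdx_sum: "pdx k (\<lambda>x y. \<Sum>i\<in>I. f i x y) x y = (\<Sum>i\<in>I. pdx k (f i) x y)"
    and pdy_sum: "pdy k (\<lambda>x y. \<Sum>i\<in>I. f i x y) x y = (\<Sum>i\<in>I. pdy k (f i) x y)"
proof -
  show "pdx k (\<lambda>x y. \<Sum>i\<in>I. f i x y) x y = (\<Sum>i\<in>I. pdx k (f i) x y)"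
    using DERIV_imp_deriv[OF DERIV_sum[where S=I, OF pdx_DERIV[OF assms xy, where k=k]]]
    by (simp add: pdx_def)
  show "pdy k (\<lambda>x y. \<Sum>i\<in>I. f i x y) x y = (\<Sum>i\<in>I. pdy k (f i) x y)"
    using DERIV_imp_deriv[OF DERIV_sum[where S=I, OF pdy_DERIV[OF assms xy, where k=k]]]
    by (simp add: pdy_def)
qed

lemma
  assumes "sm f"
  shows pdx_divide_const: "pdx k (\<lambda>x y. f x y / c) x y = pdx k f x y / c"
    and pdy_divide_const: "pdy k (\<lambda>x y. f x y / c) x y = pdy k f x y / c"
  using assms xy by (simp_all add: pdx_mult pdy_mult divide_inverse)

lemma
  assumes "\<And>x y. x \<in> U \<Longrightarrow> y \<noteq> 0 \<Longrightarrow> f x y = g x y"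
  shows pdx_cong: "pdx k f x y = pdx k g x y"
    and pdy_cong: "pdy k f x y = pdy k g x y"
proof -
  have "isCont (\<lambda>t. x + t *\<^sub>R axis k 1) 0" "isCont (\<lambda>t. y + t *\<^sub>R axis k 1) 0"
    by (auto intro!: continuous_intros)
  then have "\<forall>\<^sub>F t in at 0. x + t *\<^sub>R axis k 1 \<in> U" "\<forall>\<^sub>F t in at 0. y + t *\<^sub>R axis k 1 \<in> - {0}"
    using topological_tendstoD[of "\<lambda>t. x + t *\<^sub>R axis k 1" _ "at (0::real)" U]
      topological_tendstoD[of "\<lambda>t. y + t *\<^sub>R axis k 1" _ "at (0::real)" "- {0}"] open_U xy
    by (auto simp: isCont_def)
  then have "\<forall>\<^sub>F t in nhds 0. x + t *\<^sub>R axis k 1 \<in> U" "\<forall>\<^sub>F t in nhds 0. y + t *\<^sub>R axis k 1 \<in> - {0}"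
    using xy by (auto simp: eventually_nhds_conv_at)
  note ev = this
  have "\<forall>\<^sub>F t in nhds 0. f (x + t *\<^sub>R axis k 1) y = g (x + t *\<^sub>R axis k 1) y"
    "\<forall>\<^sub>F t in nhds 0. f x (y + t *\<^sub>R axis k 1) = g x (y + t *\<^sub>R axis k 1)"
    subgoal by (rule eventually_mono[OF ev(1)]) (simp add: assms xy)
    subgoal by (rule eventually_mono[OF ev(2)]) (simp add: assms xy)
    done
  then show "pdx k f x y = pdx k g x y" "pdy k f x y = pdy k g x y"
    unfolding pdx_def pdy_def by (auto intro!: deriv_cong_ev)
qed

text \<open>Iterated partial derivatives are values of iterated Frechet derivatives, so that the symmetry of the
latter carries over to them.\<close>

lemma frechet_pd:
  assumes "sm f"
  shows "frechet_derivative (\<lambda>z. pdx k f (fst z) (snd z)) (at (x, y)) v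
      = frechet_derivative (\<lambda>z. frechet_derivative (\<lambda>z. f (fst z) (snd z)) (at z) (axis k 1, 0)) (at (x, y)) v"
    and "frechet_derivative (\<lambda>z. pdy k f (fst z) (snd z)) (at (x, y)) v
      = frechet_derivative (\<lambda>z. frechet_derivative (\<lambda>z. f (fst z) (snd z)) (at z) (0, axis k 1)) (at (x, y)) v"
proof -
  have mem: "(x, y) \<in> U \<times> (- {0})" using xy by simp
  have d: "(\<lambda>z. pdx k f (fst z) (snd z)) differentiable at (x, y)"
    "(\<lambda>z. pdy k f (fst z) (snd z)) differentiable at (x, y)"
    using smooth_on_has_derivative[OF _ mem] sm_pdx[OF assms, of k] sm_pdy[OF assms, of k]
    unfolding smooth_tm_def differentiable_def by blast+
  show "frechet_derivative (\<lambda>z. pdx k f (fst z) (snd z)) (at (x, y)) v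
      = frechet_derivative (\<lambda>z. frechet_derivative (\<lambda>z. f (fst z) (snd z)) (at z) (axis k 1, 0)) (at (x, y)) v"
    by (subst frechet_derivative_transform_within_open[OF d(1) open_slit mem])
       (simp_all add: pdx_frechet assms mem_Times_iff)
  show "frechet_derivative (\<lambda>z. pdy k f (fst z) (snd z)) (at (x, y)) v
      = frechet_derivative (\<lambda>z. frechet_derivative (\<lambda>z. f (fst z) (snd z)) (at z) (0, axis k 1)) (at (x, y)) v"
    by (subst frechet_derivative_transform_within_open[OF d(2) open_slit mem])
       (simp_all add: pdy_frechet assms mem_Times_iff)
qed

lemma
  assumes "sm f"
  shows pdx_pdx: "pdx i (pdx j f) x y = pdx j (pdx i f) x y"
    and pdy_pdy: "pdy i (pdy j f) x y = pdy j (pdy i f) x y"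
    and pdy_pdx: "pdy i (pdx j f) x y = pdx j (pdy i f) x y"
proof -
  note C = frechet_derivative_commute[OF assms[unfolded smooth_tm_def] open_slit, of "(x, y)"]
  have mem: "(x, y) \<in> U \<times> (- {0})" using xy by simp
  show "pdx i (pdx j f) x y = pdx j (pdx i f) x y"
    unfolding pdx_frechet[OF sm_pdx[OF assms] xy] frechet_pd[OF assms] by (rule C[OF mem])
  show "pdy i (pdy j f) x y = pdy j (pdy i f) x y"
    unfolding pdy_frechet[OF sm_pdy[OF assms] xy] frechet_pd[OF assms] by (rule C[OF mem])
  show "pdy i (pdx j f) x y = pdx j (pdy i f) x y"
    unfolding pdy_frechet[OF sm_pdx[OF assms] xy] pdx_frechet[OF sm_pdy[OF assms] xy] frechet_pd[OF assms]
    by (rule C[OF mem])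
qed

end

end

section \<open>Complete lifts and the Lie derivative of a spray\<close>

lemma if_zero_mult: "(if a then b else 0) * c = (if a then b * c else (0::real))"
  "c * (if a then b else 0) = (if a then c * b else (0::real))"
  by auto

text \<open>The antisymmetric part of \<open>f\<^sub>i\<^sub>|\<^sub>j\<close>.  Only the horizontal derivatives of the components \<open>f\<^sub>i\<close> enter, because the
connection term \<open>f\<^sub>r G\<^sup>r\<^sub>i\<^sub>j\<close> of the Berwald derivative is symmetric in \<open>i, j\<close>.\<close>

definition hcurl :: "'n::finite tmfun \<Rightarrow> 'n tmfun \<Rightarrow> 'n \<Rightarrow> 'n \<Rightarrow> 'n tmfun" where
  "hcurl F f i j x y = hder F j (pdy i f) x y - hder F i (pdy j f) x y"

lemma basic_add: "basic f \<Longrightarrow> basic g \<Longrightarrow> basic (\<lambda>x y. f x y + g x y)"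
  unfolding basic_def by (intro allI arg_cong2[where f="(+)"]) blast+

lemma basic_mult: "basic f \<Longrightarrow> basic g \<Longrightarrow> basic (\<lambda>x y. f x y * g x y)"
  unfolding basic_def by (intro allI arg_cong2[where f="(*)"]) blast+

lemma basic_sum: "(\<And>i. basic (f i)) \<Longrightarrow> basic (\<lambda>x y. \<Sum>i\<in>I. f i x y)"
  unfolding basic_def by (intro allI sum.cong refl) blast

text \<open>A chart domain with exactly the analytic data that the tensor calculus uses: smoothness of the spray, the
field, the projective factor and the volume density, and the Euler identities expressing that the spray and the
projective factor have degrees 2 and 1.\<close>

locale projective_field_on = coordinate_domain U for U :: "(real^'n::finite) set" +
  fixes F P :: "'n tmfun" and W :: "real^'n \<Rightarrow> real^'n"
  assumes smooth_spray [simp]: "smooth_tm U (spray F i)"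
    and smooth_W: "smooth_on U W"
    and smooth_P [simp]: "smooth_tm U P"
    and smooth_density: "smooth_on U (\<lambda>x. ln (BH_density F x))"
    and euler_spray: "x \<in> U \<Longrightarrow> y \<noteq> 0 \<Longrightarrow> (\<Sum>j\<in>UNIV. y $ j * pdy j (spray F i) x y) = 2 * spray F i x y"
    and euler_P: "x \<in> U \<Longrightarrow> y \<noteq> 0 \<Longrightarrow> (\<Sum>j\<in>UNIV. y $ j * pdy j P x y) = P x y"
    and projective: "x \<in> U \<Longrightarrow> y \<noteq> 0 \<Longrightarrow> Lie_spray W (spray F) i x y = P x y * y $ i"
begin

abbreviation G :: "'n \<Rightarrow> 'n tmfun" where "G \<equiv> spray F"
abbreviation G1 :: "'n \<Rightarrow> 'n \<Rightarrow> 'n tmfun" where "G1 \<equiv> spray1 F"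
abbreviation w :: "'n \<Rightarrow> 'n tmfun" where "w \<equiv> vf_comp W"
abbreviation L :: "'n tmfun \<Rightarrow> 'n tmfun" where "L \<equiv> complete_lift W"
abbreviation S :: "'n tmfun" where "S \<equiv> S_curvature F"

lemma smooth_w [simp]: "sm (w i)"
proof -
  have "smooth_on U (\<lambda>x. W x $ i)"
    using smooth_W Ck_on_linear_compose[OF open_U bounded_linear_vec_nth]
    unfolding smooth_on_def by blast
  then have "sm (\<lambda>x y. W x $ i)" by (rule sm_base)
  then show ?thesis by (rule sm_cong) (simp add: vf_comp_def)
qed

lemma smooth_spray1 [simp]: "sm (G1 i j)"
  unfolding spray1_def by simp

lemma pdy_w [simp]: "pdy j (w i) x y = 0" "pdy j (pdx k (w i)) x y = 0" "pdy j (pdx l (pdx k (w i))) x y = 0"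
  by (simp_all add: pdy_basic basic_pdx basic_vf_comp)

lemmas pd_simps = pdx_add pdy_add pdx_diff pdy_diff pdx_mult pdy_mult pdx_sum pdy_sum
  pdx_divide_const pdy_divide_const

lemma lift_unfold: "L f = (\<lambda>x y. (\<Sum>i\<in>UNIV. w i x y * pdx i f x y) +
     (\<Sum>i\<in>UNIV. \<Sum>k\<in>UNIV. y $ k * pdx k (w i) x y * pdy i f x y))"
  by (intro ext) (simp add: complete_lift_def vf_comp_def)

lemma smooth_lift [simp]: "sm f \<Longrightarrow> sm (L f)"
  unfolding lift_unfold by simp

context
  fixes x y :: "real^'n"
  assumes xy: "x \<in> U" "y \<noteq> 0"
begin

lemma lift_cong:
  assumes "\<And>x y. x \<in> U \<Longrightarrow> y \<noteq> 0 \<Longrightarrow> f x y = g x y"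
  shows "L f x y = L g x y"
  unfolding complete_lift_def using pdx_cong[OF xy assms] pdy_cong[OF xy assms] by simp

lemma lift_add: "sm f \<Longrightarrow> sm g \<Longrightarrow> L (\<lambda>x y. f x y + g x y) x y = L f x y + L g x y"
  using xy by (simp add: complete_lift_def pd_simps algebra_simps sum.distrib)

lemma lift_diff: "sm f \<Longrightarrow> sm g \<Longrightarrow> L (\<lambda>x y. f x y - g x y) x y = L f x y - L g x y"
  using xy by (simp add: complete_lift_def pd_simps algebra_simps sum.distrib sum_subtractf)

lemma lift_mult: "sm f \<Longrightarrow> sm g \<Longrightarrow> L (\<lambda>x y. f x y * g x y) x y = L f x y * g x y + f x y * L g x y"
  using xy by (simp add: complete_lift_def pd_simps algebra_simps sum.distrib sum_distrib_left)

lemma lift_sum: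
  assumes "\<And>i. i \<in> I \<Longrightarrow> sm (f i)"
  shows "L (\<lambda>x y. \<Sum>i\<in>I. f i x y) x y = (\<Sum>i\<in>I. L (f i) x y)"
  using assms
proof (induction I rule: infinite_finite_induct)
  case (insert i I)
  then have "L (\<lambda>x y. f i x y + (\<Sum>i\<in>I. f i x y)) x y = L (f i) x y + L (\<lambda>x y. \<Sum>i\<in>I. f i x y) x y"
    by (intro lift_add) auto
  then show ?case using insert by simp
qed (use xy in \<open>auto simp: complete_lift_def\<close>)

lemma lift_coord: "L (\<lambda>x y. y $ i) x y = (\<Sum>k\<in>UNIV. y $ k * pdx k (w i) x y)"
proof -
  have "(\<Sum>j\<in>UNIV. \<Sum>k\<in>UNIV. y $ k * pdx k (w j) x y * (if i = j then 1 else 0))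
    = (\<Sum>k\<in>UNIV. \<Sum>j\<in>UNIV. y $ k * pdx k (w j) x y * (if i = j then 1 else 0))"
    by (rule sum.swap)
  also have "\<dots> = (\<Sum>k\<in>UNIV. y $ k * pdx k (w i) x y)"
    by (simp add: if_zero_mult)
  finally show ?thesis using xy by (simp add: complete_lift_def)
qed

text \<open>The commutator of a vertical derivative with the complete lift is again vertical; the one of a
horizontal coordinate derivative also picks up the second derivatives of the vector field.\<close>

lemma pdy_lift:
  assumes "sm f"
  shows "pdy j (L f) x y = L (pdy j f) x y + (\<Sum>k\<in>UNIV. pdx j (w k) x y * pdy k f x y)"
  unfolding lift_unfold using xy assms
  by (simp add: pd_simps pdy_pdx pdy_pdy[of _ _ _ j] distrib_right if_zero_mult sum.distrib)

lemma pdx_lift: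
  assumes "sm f"
  shows "pdx j (L f) x y = L (pdx j f) x y + (\<Sum>k\<in>UNIV. pdx j (w k) x y * pdx k f x y)
     + (\<Sum>k\<in>UNIV. \<Sum>l\<in>UNIV. y $ l * pdx j (pdx l (w k)) x y * pdy k f x y)"
  unfolding lift_unfold using xy assms
  by (simp add: pd_simps pdx_pdx[of _ _ _ j] pdy_pdx distrib_right sum.distrib)

lemma lift_spray:
  "L (G i) x y = P x y * y $ i + (\<Sum>k\<in>UNIV. G k x y * pdx k (w i) x y)
     - 1/2 * (\<Sum>j\<in>UNIV. \<Sum>k\<in>UNIV. y $ j * y $ k * pdx k (pdx j (w i)) x y)"
  using projective[OF xy, of i] by (simp add: Lie_spray_def)

end

text \<open>The vertical derivative of the projectivity equation.  Read as a Lie derivative it says that \<open>G\<^sup>i\<^sub>j\<close>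
changes by \<open>P\<^sub>j y\<^sup>i + P \<delta>\<^sup>i\<^sub>j\<close>; the other terms belong to the Lie derivative of a connection.\<close>

lemma lift_spray1:
  assumes xy: "x \<in> U" "y \<noteq> 0"
  shows "L (G1 i j) x y = pdy j P x y * y $ i + (if i = j then P x y else 0)
     + (\<Sum>k\<in>UNIV. G1 k j x y * pdx k (w i) x y)
     - (\<Sum>k\<in>UNIV. pdx j (w k) x y * G1 i k x y)
     - (\<Sum>k\<in>UNIV. y $ k * pdx j (pdx k (w i)) x y)"
proof -
  have "pdy j (L (G i)) x y = pdy j (\<lambda>x y. P x y * y $ i + (\<Sum>k\<in>UNIV. G k x y * pdx k (w i) x y)
     - 1/2 * (\<Sum>j\<in>UNIV. \<Sum>k\<in>UNIV. y $ j * y $ k * pdx k (pdx j (w i)) x y)) x y"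
    by (rule pdy_cong[OF xy]) (rule lift_spray)
  also have "\<dots> = pdy j P x y * y $ i + (if i = j then P x y else 0)
     + (\<Sum>k\<in>UNIV. G1 k j x y * pdx k (w i) x y)
     - 1/2 * (\<Sum>l\<in>UNIV. \<Sum>k\<in>UNIV. ((if l = j then 1 else 0) * y $ k + y $ l * (if k = j then 1 else 0)) * pdx k (pdx l (w i)) x y)"
    using xy by (simp add: pd_simps spray1_def if_zero_mult)
  also have "(\<Sum>l\<in>UNIV. \<Sum>k\<in>UNIV. ((if l = j then 1 else 0) * y $ k + y $ l * (if k = j then 1 else 0)) * pdx k (pdx l (w i)) x y)
    = (\<Sum>l\<in>UNIV. \<Sum>k\<in>UNIV. (if l = j then 1 else 0) * (y $ k * pdx k (pdx l (w i)) x y))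
      + (\<Sum>l\<in>UNIV. \<Sum>k\<in>UNIV. (if k = j then 1 else 0) * (y $ l * pdx k (pdx l (w i)) x y))"
    by (simp add: algebra_simps sum.distrib)
  also have "\<dots> = (\<Sum>k\<in>UNIV. y $ k * pdx k (pdx j (w i)) x y) + (\<Sum>l\<in>UNIV. y $ l * pdx j (pdx l (w i)) x y)"
    by (subst sum.swap) (simp add: if_zero_mult)
  also have "\<dots> = 2 * (\<Sum>k\<in>UNIV. y $ k * pdx j (pdx k (w i)) x y)"
    using xy by (simp add: pdx_pdx[of _ _ _ _ j])
  finally show ?thesis
    using pdy_lift[OF xy smooth_spray, of j i] by (simp add: spray1_def)
qed

lemma smooth_hder [simp]: "sm f \<Longrightarrow> sm (hder F j f)"
  by (subst sm_cong[of "\<lambda>x y. pdx j f x y - (\<Sum>i\<in>UNIV. spray1 F i j x y * pdy i f x y)"]) (auto simp: hder_def)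

section \<open>Horizontal derivatives along a projective field\<close>

lemma hder_cong:
  assumes "x \<in> U" "y \<noteq> 0" "\<And>x y. x \<in> U \<Longrightarrow> y \<noteq> 0 \<Longrightarrow> f x y = g x y"
  shows "hder F j f x y = hder F j g x y"
  unfolding hder_def using pdx_cong[OF assms] pdy_cong[OF assms] by simp

lemma smooth_hcurl [simp]: "sm f \<Longrightarrow> sm (hcurl F f i j)"
  by (subst sm_cong[of "\<lambda>x y. hder F j (pdy i f) x y - hder F i (pdy j f) x y"]) (auto simp: hcurl_def)

text \<open>How far the complete lift is from commuting with \<open>f \<mapsto> f\<^sub>i\<^sub>|\<^sub>j\<close>.  The two sums with horizontal derivatives
make \<open>L\<close> into the Lie derivative of a 2-tensor.  Of the change of \<open>G\<^sup>r\<^sub>j\<close>, the part \<open>P\<^sub>j y\<^sup>r\<close> is lost by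
homogeneity and the part \<open>P \<delta>\<^sup>r\<^sub>j\<close> gives \<open>P f\<^sub>i\<^sub>j\<close>.  That term and
the last sum, which comes from the second derivatives of the field, are symmetric in \<open>i, j\<close>.\<close>

lemma hder_lift:
  assumes f: "sm f" and xy: "x \<in> U" "y \<noteq> 0"
    and hom: "\<And>i. (\<Sum>r\<in>UNIV. y $ r * pdy r (pdy i f) x y) = 0"
  shows "hder F j (pdy i (L f)) x y = L (hder F j (pdy i f)) x y
    + (\<Sum>k\<in>UNIV. hder F j (pdy k f) x y * pdx i (w k) x y)
    + (\<Sum>k\<in>UNIV. hder F k (pdy i f) x y * pdx j (w k) x y)
    + P x y * pdy j (pdy i f) x y + (\<Sum>k\<in>UNIV. pdx j (pdx i (w k)) x y * pdy k f x y)"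
proof -
  define g where "g = pdy i f"
  have g [simp]: "sm g" using f by (simp add: g_def)
  define h where "h = (\<lambda>x y. L g x y + (\<Sum>k\<in>UNIV. pdx i (w k) x y * pdy k f x y))"
  have "hder F j (pdy i (L f)) x y = hder F j h x y"
    unfolding h_def g_def by (rule hder_cong[OF xy pdy_lift[OF _ _ f]])
  also have "\<dots> = pdx j (L g) x y - (\<Sum>r\<in>UNIV. G1 r j x y * pdy r (L g) x y)
    + (\<Sum>k\<in>UNIV. hder F j (pdy k f) x y * pdx i (w k) x y)
    + (\<Sum>k\<in>UNIV. pdx j (pdx i (w k)) x y * pdy k f x y)"
  proof -
    have "(\<Sum>r\<in>UNIV. G1 r j x y * (\<Sum>k\<in>UNIV. pdx i (w k) x y * pdy r (pdy k f) x y))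
      = (\<Sum>k\<in>UNIV. (\<Sum>r\<in>UNIV. G1 r j x y * pdy r (pdy k f) x y) * pdx i (w k) x y)"
      unfolding sum_distrib_left sum_distrib_right by (subst sum.swap) (simp add: mult_ac)
    then show ?thesis
      using xy f by (simp add: hder_def h_def pd_simps sum.distrib algebra_simps sum_subtractf)
  qed
  also have "pdx j (L g) x y - (\<Sum>r\<in>UNIV. G1 r j x y * pdy r (L g) x y)
    = L (hder F j g) x y + (\<Sum>k\<in>UNIV. hder F k g x y * pdx j (w k) x y) + P x y * pdy j g x y"
  proof -
    let ?w2 = "\<lambda>r l. y $ l * pdx j (pdx l (w r)) x y"
    have lift_h: "L (hder F j g) x y = L (pdx j g) x y
        - (\<Sum>r\<in>UNIV. L (G1 r j) x y * pdy r g x y) - (\<Sum>r\<in>UNIV. G1 r j x y * L (pdy r g) x y)"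
      using xy lift_cong[OF xy, of "hder F j g" "\<lambda>x y. pdx j g x y - (\<Sum>r\<in>UNIV. G1 r j x y * pdy r g x y)"]
      by (simp add: hder_def lift_diff lift_sum lift_mult sum.distrib)
    have s1: "(\<Sum>r\<in>UNIV. L (G1 r j) x y * pdy r g x y) = 
        pdy j P x y * (\<Sum>r\<in>UNIV. y $ r * pdy r g x y) + P x y * pdy j g x y
        + (\<Sum>r\<in>UNIV. (\<Sum>k\<in>UNIV. G1 k j x y * pdx k (w r) x y) * pdy r g x y)
        - (\<Sum>r\<in>UNIV. (\<Sum>k\<in>UNIV. pdx j (w k) x y * G1 r k x y) * pdy r g x y)
        - (\<Sum>r\<in>UNIV. (\<Sum>l\<in>UNIV. ?w2 r l) * pdy r g x y)"
      using xy by (simp add: lift_spray1 algebra_simps sum.distrib sum_subtractf if_zero_mult sum_distrib_left)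
    have s2: "(\<Sum>r\<in>UNIV. G1 r j x y * pdy r (L g) x y) = (\<Sum>r\<in>UNIV. G1 r j x y * L (pdy r g) x y)
        + (\<Sum>r\<in>UNIV. G1 r j x y * (\<Sum>k\<in>UNIV. pdx r (w k) x y * pdy k g x y))"
      using xy by (simp add: pdy_lift distrib_left sum.distrib)
    have s3: "(\<Sum>r\<in>UNIV. G1 r j x y * (\<Sum>k\<in>UNIV. pdx r (w k) x y * pdy k g x y))
        = (\<Sum>r\<in>UNIV. (\<Sum>k\<in>UNIV. G1 k j x y * pdx k (w r) x y) * pdy r g x y)"
      unfolding sum_distrib_left sum_distrib_right by (subst sum.swap) (simp add: mult_ac)
    have s4: "(\<Sum>k\<in>UNIV. (\<Sum>r\<in>UNIV. G1 r k x y * pdy r g x y) * pdx j (w k) x y)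
        = (\<Sum>r\<in>UNIV. (\<Sum>k\<in>UNIV. pdx j (w k) x y * G1 r k x y) * pdy r g x y)"
      unfolding sum_distrib_left sum_distrib_right by (subst sum.swap) (simp add: mult_ac)
    have s5: "(\<Sum>k\<in>UNIV. hder F k g x y * pdx j (w k) x y) = (\<Sum>k\<in>UNIV. pdx j (w k) x y * pdx k g x y)
       - (\<Sum>r\<in>UNIV. (\<Sum>k\<in>UNIV. pdx j (w k) x y * G1 r k x y) * pdy r g x y)"
      unfolding s4[symmetric] by (simp add: hder_def left_diff_distrib sum_subtractf mult.commute[of "pdx j (w _) x y"])
    have s6: "(\<Sum>r\<in>UNIV. y $ r * pdy r g x y) = 0" using hom by (simp add: g_def)
    have s7: "(\<Sum>k\<in>UNIV. \<Sum>l\<in>UNIV. ?w2 k l * pdy k g x y) = (\<Sum>r\<in>UNIV. (\<Sum>l\<in>UNIV. ?w2 r l) * pdy r g x y)"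
      by (simp add: sum_distrib_right)
    show ?thesis
      unfolding lift_h s1 s2 s3 s5 s6 pdx_lift[OF xy g] s7 by simp
  qed
  finally show ?thesis by (simp add: g_def)
qed

text \<open>The error terms of the preceding lemma cancel under antisymmetrization.\<close>

lemma Lie_hcurl:
  assumes f: "sm f" and xy: "x \<in> U" "y \<noteq> 0"
    and hom: "\<And>i. (\<Sum>r\<in>UNIV. y $ r * pdy r (pdy i f) x y) = 0"
  shows "Lie_tensor2 W (hcurl F f) i j x y = hcurl F (L f) i j x y"
proof -
  have "L (hcurl F f i j) x y = L (hder F j (pdy i f)) x y - L (hder F i (pdy j f)) x y"
    using lift_cong[OF xy, of "hcurl F f i j" "\<lambda>x y. hder F j (pdy i f) x y - hder F i (pdy j f) x y"] f xy
    by (simp add: hcurl_def lift_diff)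
  then show ?thesis
    using xy f
    by (simp add: Lie_tensor2_def hcurl_def hder_lift hom left_diff_distrib sum_subtractf
        pdy_pdy[of _ _ _ j i] pdx_pdx[of _ _ _ j i])
qed

section \<open>The curvatures and their Lie derivatives\<close>

text \<open>Vertical differentiation lowers the degree of homogeneity by one.\<close>

lemma euler_pdy:
  assumes f: "sm f" and hom: "\<And>x y. x \<in> U \<Longrightarrow> y \<noteq> 0 \<Longrightarrow> (\<Sum>r\<in>UNIV. y $ r * pdy r f x y) = c * f x y"
    and xy: "x \<in> U" "y \<noteq> 0"
  shows "(\<Sum>r\<in>UNIV. y $ r * pdy r (pdy j f) x y) = (c - 1) * pdy j f x y"
proof -
  have "pdy j (\<lambda>x y. \<Sum>r\<in>UNIV. y $ r * pdy r f x y) x y = pdy j (\<lambda>x y. c * f x y) x y"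
    by (rule pdy_cong[OF xy hom])
  then show ?thesis
    using f xy by (simp add: pd_simps if_zero_mult sum.distrib pdy_pdy[of _ _ _ j] algebra_simps)
qed

lemma euler_spray1:
  assumes xy: "x \<in> U" "y \<noteq> 0"
  shows "(\<Sum>r\<in>UNIV. y $ r * pdy r (G1 i j) x y) = G1 i j x y"
  using euler_pdy[OF smooth_spray euler_spray xy] by (simp add: spray1_def)

abbreviation log_density :: "'n tmfun" where "log_density \<equiv> \<lambda>x y. ln (BH_density F x)"

lemma smooth_log_density [simp]: "sm log_density"
  by (rule sm_base[OF smooth_density])

lemma S_unfold: "S = (\<lambda>x y. (\<Sum>m\<in>UNIV. G1 m m x y) - (\<Sum>m\<in>UNIV. y $ m * pdx m log_density x y))"
  by (intro ext) (simp add: S_curvature_def)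

lemma smooth_S [simp]: "sm S"
  unfolding S_unfold by simp

lemma euler_S:
  assumes xy: "x \<in> U" "y \<noteq> 0"
  shows "(\<Sum>r\<in>UNIV. y $ r * pdy r S x y) = S x y"
proof -
  have *: "pdy r S x y = (\<Sum>m\<in>UNIV. pdy r (G1 m m) x y) - pdx r log_density x y" for r
    unfolding S_unfold using xy by (simp add: pd_simps if_zero_mult pdy_basic basic_pdx)
  have "(\<Sum>r\<in>UNIV. y $ r * pdy r S x y)
     = (\<Sum>m\<in>UNIV. \<Sum>r\<in>UNIV. y $ r * pdy r (G1 m m) x y) - (\<Sum>r\<in>UNIV. y $ r * pdx r log_density x y)"
    unfolding * right_diff_distrib sum_subtractf sum_distrib_left by (subst sum.swap) simp
  then show ?thesis using xy by (simp add: euler_spray1 S_unfold)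
qed

lemma euler_pdy_S:
  assumes xy: "x \<in> U" "y \<noteq> 0"
  shows "(\<Sum>r\<in>UNIV. y $ r * pdy r (pdy j S) x y) = 0"
  using euler_pdy[OF smooth_S, of 1 x y j] euler_S xy by simp

text \<open>The divergence of the vector field with respect to the volume form \<open>\<sigma>\<^sub>F dx\<close>.\<close>

definition div_vol :: "'n tmfun" where
  "div_vol x y = (\<Sum>m\<in>UNIV. pdx m (w m) x y) + (\<Sum>m\<in>UNIV. w m x y * pdx m log_density x y)"

lemma div_vol_unfold: "div_vol = (\<lambda>x y. (\<Sum>m\<in>UNIV. pdx m (w m) x y) + (\<Sum>m\<in>UNIV. w m x y * pdx m log_density x y))"
  by (intro ext) (simp add: div_vol_def)

lemma smooth_div_vol [simp]: "sm div_vol"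
  unfolding div_vol_unfold by simp

lemma basic_div_vol: "basic div_vol"
  unfolding div_vol_unfold
  by (intro basic_add basic_sum basic_mult basic_pdx basic_vf_comp basic_fun)

text \<open>The trace of \<open>lift_spray1\<close>: the terms with \<open>G\<^sup>i\<^sub>k\<close> cancel, the terms with \<open>P\<close> give \<open>(n+1) P\<close> by Euler's
identity, and the second derivatives of the field combine with the density to the differential
of the divergence.\<close>

lemma lift_S:
  assumes xy: "x \<in> U" "y \<noteq> 0"
  shows "L S x y = (real CARD('n) + 1) * P x y - (\<Sum>k\<in>UNIV. y $ k * pdx k div_vol x y)"
proof -
  have a: "(\<Sum>m\<in>UNIV. L (G1 m m) x y) = (real CARD('n) + 1) * P x y
      - (\<Sum>k\<in>UNIV. \<Sum>m\<in>UNIV. y $ k * pdx k (pdx m (w m)) x y)"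
  proof -
    have 1: "(\<Sum>m\<in>UNIV. \<Sum>k\<in>UNIV. G1 k m x y * pdx k (w m) x y)
        = (\<Sum>m\<in>UNIV. \<Sum>k\<in>UNIV. pdx m (w k) x y * G1 m k x y)"
      by (subst sum.swap) (simp add: mult_ac)
    have 2: "(\<Sum>m\<in>UNIV. \<Sum>k\<in>UNIV. y $ k * pdx m (pdx k (w m)) x y)
        = (\<Sum>k\<in>UNIV. \<Sum>m\<in>UNIV. y $ k * pdx k (pdx m (w m)) x y)"
      using xy by (subst sum.swap) (simp add: pdx_pdx[of _ _ "w _"])
    have "(\<Sum>m\<in>UNIV. L (G1 m m) x y) = (\<Sum>m\<in>UNIV. y $ m * pdy m P x y) + real CARD('n) * P x y
        + (\<Sum>m\<in>UNIV. \<Sum>k\<in>UNIV. G1 k m x y * pdx k (w m) x y)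
        - (\<Sum>m\<in>UNIV. \<Sum>k\<in>UNIV. pdx m (w k) x y * G1 m k x y)
        - (\<Sum>m\<in>UNIV. \<Sum>k\<in>UNIV. y $ k * pdx m (pdx k (w m)) x y)"
      using xy by (simp add: lift_spray1 sum.distrib sum_subtractf mult.commute)
    then show ?thesis unfolding 1 2 using xy by (simp add: euler_P algebra_simps)
  qed
  have b: "(\<Sum>m\<in>UNIV. L (\<lambda>x y. y $ m * pdx m log_density x y) x y)
      = (\<Sum>k\<in>UNIV. \<Sum>m\<in>UNIV. y $ k * (pdx k (w m) x y * pdx m log_density x y + w m x y * pdx k (pdx m log_density) x y))"
  proof -
    have "L (pdx m log_density) x y = (\<Sum>i\<in>UNIV. w i x y * pdx m (pdx i log_density) x y)" for m
      using xy by (simp add: complete_lift_def vf_comp_def pdy_basic basic_pdx pdx_pdx[of _ _ log_density m])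
    then have "(\<Sum>m\<in>UNIV. L (\<lambda>x y. y $ m * pdx m log_density x y) x y)
      = (\<Sum>m\<in>UNIV. \<Sum>k\<in>UNIV. y $ k * (pdx k (w m) x y * pdx m log_density x y))
      + (\<Sum>m\<in>UNIV. \<Sum>k\<in>UNIV. y $ m * (w k x y * pdx m (pdx k log_density) x y))"
      using xy by (simp add: lift_mult lift_coord sum.distrib sum_distrib_left sum_distrib_right mult_ac)
    also have "(\<Sum>m\<in>UNIV. \<Sum>k\<in>UNIV. y $ k * (pdx k (w m) x y * pdx m log_density x y))
      = (\<Sum>k\<in>UNIV. \<Sum>m\<in>UNIV. y $ k * (pdx k (w m) x y * pdx m log_density x y))"
      by (rule sum.swap)
    finally show ?thesis by (simp add: distrib_left sum.distrib)
  qed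
  have c: "(\<Sum>k\<in>UNIV. y $ k * pdx k div_vol x y) = (\<Sum>k\<in>UNIV. \<Sum>m\<in>UNIV. y $ k * pdx k (pdx m (w m)) x y)
     + (\<Sum>k\<in>UNIV. \<Sum>m\<in>UNIV. y $ k * (pdx k (w m) x y * pdx m log_density x y + w m x y * pdx k (pdx m log_density) x y))"
    unfolding div_vol_unfold using xy
    by (simp add: pd_simps distrib_left sum.distrib sum_distrib_left)
  have "L S x y = (\<Sum>m\<in>UNIV. L (G1 m m) x y) - (\<Sum>m\<in>UNIV. L (\<lambda>x y. y $ m * pdx m log_density x y) x y)"
    unfolding S_unfold using xy by (simp add: lift_diff lift_sum)
  then show ?thesis unfolding a b c by simp
qed

text \<open>The function \<open>y\<^sup>k \<partial>\<^sub>k \<phi>\<close> has vertical derivatives \<open>\<partial>\<^sub>i \<phi>\<close>, whose curl vanishes because second derivatives commute.\<close>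

lemma hcurl_lift_S:
  assumes xy: "x \<in> U" "y \<noteq> 0"
  shows "hcurl F (L S) i j x y = (real CARD('n) + 1) * hcurl F P i j x y"
proof -
  have "hder F j (pdy i (L S)) x y = (real CARD('n) + 1) * hder F j (pdy i P) x y - pdx j (pdx i div_vol) x y" for i j
  proof -
    have "pdy i (L S) x y = (real CARD('n) + 1) * pdy i P x y - pdx i div_vol x y"
      if xy: "x \<in> U" "y \<noteq> 0" for x y
    proof -
      have "pdy i (L S) x y = pdy i (\<lambda>x y. (real CARD('n) + 1) * P x y - (\<Sum>k\<in>UNIV. y $ k * pdx k div_vol x y)) x y"
        by (rule pdy_cong[OF xy lift_S])
      then show ?thesis
        using xy by (simp add: pd_simps pdy_basic basic_pdx basic_div_vol if_zero_mult)
    qed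
    then have "hder F j (pdy i (L S)) x y
       = hder F j (\<lambda>x y. (real CARD('n) + 1) * pdy i P x y - pdx i div_vol x y) x y"
      by (rule hder_cong[OF xy])
    also have "\<dots> = (real CARD('n) + 1) * hder F j (pdy i P) x y - pdx j (pdx i div_vol) x y"
    proof -
      have "(\<Sum>r\<in>UNIV. G1 r j x y * ((real CARD('n) + 1) * pdy r (pdy i P) x y))
        = (real CARD('n) + 1) * (\<Sum>r\<in>UNIV. G1 r j x y * pdy r (pdy i P) x y)"
        by (simp add: sum_distrib_left mult_ac)
      then show ?thesis
        unfolding hder_def using xy
        by (simp add: pd_simps pdy_basic basic_pdx basic_div_vol right_diff_distrib)
    qed
    finally show ?thesis .
  qed
  then show ?thesis
    using pdx_pdx[OF xy smooth_div_vol, of j i] by (simp add: hcurl_def right_diff_distrib)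
qed

lemma hder_covec_curl:
  assumes f: "sm f" and xy: "x \<in> U" "y \<noteq> 0"
  shows "hder_covec F (\<lambda>r. pdy r f) i j x y - hder_covec F (\<lambda>r. pdy r f) j i x y = hcurl F f i j x y"
  using xy by (simp add: hder_covec_def hcurl_def spray2_def spray1_def pdy_pdy[of _ _ "G _" i j])

lemma Sigma_hcurl:
  assumes xy: "x \<in> U" "y \<noteq> 0"
  shows "Sigma_curvature F i j x y = hcurl F S i j x y / (real CARD('n) + 1)"
  unfolding Sigma_curvature_def using hder_covec_curl[OF smooth_S xy] by simp

lemma Lie_Sigma:
  assumes xy: "x \<in> U" "y \<noteq> 0"
  shows "Lie_tensor2 W (Sigma_curvature F) i j x y = hcurl F P i j x y"
proof -
  let ?c = "real CARD('n) + 1"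
  have "L (Sigma_curvature F i j) x y = L (\<lambda>x y. inverse ?c * hcurl F S i j x y) x y"
    by (rule lift_cong[OF xy]) (simp add: Sigma_hcurl divide_inverse mult.commute)
  also have "\<dots> = inverse ?c * L (hcurl F S i j) x y"
    using xy by (simp add: lift_mult, simp add: complete_lift_def)
  finally have "Lie_tensor2 W (Sigma_curvature F) i j x y = inverse ?c * Lie_tensor2 W (hcurl F S) i j x y"
    using xy by (simp add: Lie_tensor2_def Sigma_hcurl distrib_left sum_distrib_left divide_inverse mult_ac)
  also have "\<dots> = inverse ?c * (?c * hcurl F P i j x y)"
    using Lie_hcurl[OF smooth_S xy euler_pdy_S[OF xy]] hcurl_lift_S[OF xy] by simp
  finally show ?thesis by (simp add: add_nonneg_pos flip: mult.assoc)
qed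

text \<open>Contracting the index of a vertical derivative with \<open>y\<close> commutes with horizontal differentiation, since the
contraction of the second vertical derivatives vanishes by homogeneity.\<close>

lemma euler_hder:
  assumes f: "sm f" and hom: "\<And>x y. x \<in> U \<Longrightarrow> y \<noteq> 0 \<Longrightarrow> (\<Sum>r\<in>UNIV. y $ r * pdy r f x y) = f x y"
    and xy: "x \<in> U" "y \<noteq> 0"
  shows "(\<Sum>m\<in>UNIV. y $ m * hder F i (pdy m f) x y) = pdx i f x y"
proof -
  have 0: "(\<Sum>m\<in>UNIV. y $ m * pdy r (pdy m f) x y) = 0" for r
    using euler_pdy[OF f, of 1 x y r] hom xy f by (simp add: pdy_pdy[of _ _ f r])
  have 1: "pdx i f x y = (\<Sum>m\<in>UNIV. y $ m * pdx i (pdy m f) x y)"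
  proof -
    have "pdx i (\<lambda>x y. \<Sum>r\<in>UNIV. y $ r * pdy r f x y) x y = pdx i f x y"
      by (rule pdx_cong[OF xy hom])
    then show ?thesis using f xy by (simp add: pd_simps)
  qed
  have "(\<Sum>m\<in>UNIV. y $ m * (\<Sum>r\<in>UNIV. G1 r i x y * pdy r (pdy m f) x y))
     = (\<Sum>r\<in>UNIV. G1 r i x y * (\<Sum>m\<in>UNIV. y $ m * pdy r (pdy m f) x y))"
    unfolding sum_distrib_left by (subst sum.swap) (simp add: mult_ac)
  then show ?thesis by (simp add: hder_def right_diff_distrib sum_subtractf 0 1)
qed

lemma Xi_hcurl:
  assumes xy: "x \<in> U" "y \<noteq> 0"
  shows "Xi_curvature F i x y = (\<Sum>m\<in>UNIV. y $ m * hcurl F S i m x y)"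
proof -
  have "(\<Sum>m\<in>UNIV. y $ m * (\<Sum>r\<in>UNIV. pdy r S x y * spray2 F r i m x y))
     = (\<Sum>r\<in>UNIV. pdy r S x y * (\<Sum>m\<in>UNIV. y $ m * pdy m (G1 r i) x y))"
    unfolding sum_distrib_left spray2_def by (subst sum.swap) (simp add: mult_ac)
  also have "\<dots> = (\<Sum>r\<in>UNIV. G1 r i x y * pdy r S x y)"
    using xy by (simp add: euler_spray1 mult.commute)
  finally have 1: "(\<Sum>m\<in>UNIV. y $ m * (\<Sum>r\<in>UNIV. pdy r S x y * spray2 F r i m x y)) = \<dots>" .
  have "Xi_curvature F i x y = (\<Sum>m\<in>UNIV. y $ m * hder F m (pdy i S) x y) - pdx i S x y"
    unfolding Xi_curvature_def hder_covec_def right_diff_distrib sum_subtractf 1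
    by (simp add: hder_def[of F i S])
  then show ?thesis
    using euler_hder[OF smooth_S euler_S xy, of i] by (simp add: hcurl_def right_diff_distrib sum_subtractf)
qed

lemma Lie_Xi:
  assumes xy: "x \<in> U" "y \<noteq> 0"
  shows "Lie_covec W (Xi_curvature F) i x y = (real CARD('n) + 1) * (\<Sum>m\<in>UNIV. y $ m * hcurl F P i m x y)"
proof -
  let ?A = "hcurl F S"
  have "L (Xi_curvature F i) x y = L (\<lambda>x y. \<Sum>m\<in>UNIV. y $ m * ?A i m x y) x y"
    by (rule lift_cong[OF xy Xi_hcurl])
  also have "\<dots> = (\<Sum>m\<in>UNIV. (\<Sum>k\<in>UNIV. y $ k * pdx k (w m) x y) * ?A i m x y) + (\<Sum>m\<in>UNIV. y $ m * L (?A i m) x y)"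
    using xy by (simp add: lift_sum lift_mult lift_coord sum.distrib)
  also have "(\<Sum>m\<in>UNIV. (\<Sum>k\<in>UNIV. y $ k * pdx k (w m) x y) * ?A i m x y)
     = (\<Sum>m\<in>UNIV. y $ m * (\<Sum>k\<in>UNIV. ?A i k x y * pdx m (w k) x y))"
    unfolding sum_distrib_left sum_distrib_right by (subst sum.swap) (simp add: mult_ac)
  finally have 1: "L (Xi_curvature F i) x y = \<dots> + (\<Sum>m\<in>UNIV. y $ m * L (?A i m) x y)" .
  have 2: "(\<Sum>k\<in>UNIV. Xi_curvature F k x y * pdx i (w k) x y)
     = (\<Sum>m\<in>UNIV. y $ m * (\<Sum>k\<in>UNIV. ?A k m x y * pdx i (w k) x y))"
    unfolding Xi_hcurl[OF xy] sum_distrib_left sum_distrib_right by (subst sum.swap) (simp add: mult_ac)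
  have "Lie_covec W (Xi_curvature F) i x y = (\<Sum>m\<in>UNIV. y $ m * Lie_tensor2 W ?A i m x y)"
    unfolding Lie_covec_def 1 2 by (simp add: Lie_tensor2_def distrib_left sum.distrib)
  also have "\<dots> = (\<Sum>m\<in>UNIV. y $ m * ((real CARD('n) + 1) * hcurl F P i m x y))"
    using Lie_hcurl[OF smooth_S xy euler_pdy_S[OF xy]] hcurl_lift_S[OF xy] by simp
  finally show ?thesis by (simp add: sum_distrib_left mult_ac)
qed

text \<open>The contraction \<open>Q\<^sub>i = y\<^sup>m A\<^sub>i\<^sub>m(P)\<close> determines \<open>A(P)\<close>: the derivative of \<open>Q\<^sub>i\<close> with respect to \<open>y\<^sup>j\<close> consists of
terms symmetric in \<open>i, j\<close> and of \<open>A\<^sub>i\<^sub>j(P)\<close>, so its antisymmetric part recovers \<open>A(P)\<close>.\<close>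

lemma hcurl_zero_of_contraction_zero:
  assumes van: "\<And>x y i. x \<in> U \<Longrightarrow> y \<noteq> 0 \<Longrightarrow> (\<Sum>m\<in>UNIV. y $ m * hcurl F P i m x y) = 0"
    and xy: "x \<in> U" "y \<noteq> 0"
  shows "hcurl F P i j x y = 0"
proof -
  \<comment> \<open>The contraction of \<open>G\<^sup>r\<^sub>m\<close> with \<open>y\<^sup>m\<close> is \<open>2 G\<^sup>r\<close>, and the other half of the curl contracts to \<open>\<partial>\<^sub>i P\<close>.\<close>
  have Q: "(\<Sum>m\<in>UNIV. y $ m * pdx m (pdy i P) x y) - 2 * (\<Sum>r\<in>UNIV. G r x y * pdy r (pdy i P) x y) - pdx i P x y = 0"
    if xy: "x \<in> U" "y \<noteq> 0" for x y i
  proof -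
    have "(\<Sum>m\<in>UNIV. y $ m * (\<Sum>r\<in>UNIV. G1 r m x y * pdy r (pdy i P) x y))
      = (\<Sum>r\<in>UNIV. (\<Sum>m\<in>UNIV. y $ m * G1 r m x y) * pdy r (pdy i P) x y)"
      unfolding sum_distrib_left sum_distrib_right by (subst sum.swap) (simp add: mult_ac)
    also have "\<dots> = 2 * (\<Sum>r\<in>UNIV. G r x y * pdy r (pdy i P) x y)"
      unfolding spray1_def euler_spray[OF xy] by (simp add: sum_distrib_left mult_ac)
    finally have "(\<Sum>m\<in>UNIV. y $ m * hder F m (pdy i P) x y)
      = (\<Sum>m\<in>UNIV. y $ m * pdx m (pdy i P) x y) - 2 * (\<Sum>r\<in>UNIV. G r x y * pdy r (pdy i P) x y)"
      by (simp add: hder_def right_diff_distrib sum_subtractf)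
    then show ?thesis
      using van[OF xy, of i] euler_hder[OF smooth_P euler_P xy, of i]
      by (simp add: hcurl_def right_diff_distrib sum_subtractf)
  qed
  have D: "pdx j (pdy i P) x y + (\<Sum>m\<in>UNIV. y $ m * pdx m (pdy j (pdy i P)) x y)
     - 2 * ((\<Sum>r\<in>UNIV. G1 r j x y * pdy r (pdy i P) x y) + (\<Sum>r\<in>UNIV. G r x y * pdy r (pdy j (pdy i P)) x y))
     - pdx i (pdy j P) x y = 0" for i j
  proof -
    have "pdy j (\<lambda>x y. (\<Sum>m\<in>UNIV. y $ m * pdx m (pdy i P) x y)
        - 2 * (\<Sum>r\<in>UNIV. G r x y * pdy r (pdy i P) x y) - pdx i P x y) x y = pdy j (\<lambda>x y. 0) x y"
      by (rule pdy_cong[OF xy Q])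
    moreover have "pdy j (pdx m (pdy i P)) x y = pdx m (pdy j (pdy i P)) x y"
      "pdy j (pdx i P) x y = pdx i (pdy j P) x y"
      "pdy j (pdy r (pdy i P)) x y = pdy r (pdy j (pdy i P)) x y" for m r
      using xy by (simp_all add: pdy_pdx pdy_pdy[of _ _ "pdy i P" j r])
    ultimately show ?thesis
      using xy by (simp add: pd_simps if_zero_mult sum.distrib spray1_def)
  qed
  \<comment> \<open>The terms of third order are symmetric in \<open>i, j\<close> and drop out of the difference.\<close>
  have s: "pdx m (pdy j (pdy i P)) x y = pdx m (pdy i (pdy j P)) x y"
     "pdy m (pdy j (pdy i P)) x y = pdy m (pdy i (pdy j P)) x y" for m
    by (intro pdx_cong pdy_cong xy pdy_pdy smooth_P; assumption)+
  show ?thesis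
    using D[of j i] D[of i j] unfolding s by (simp add: hcurl_def hder_def)
qed

lemma local_equivalence:
  "(\<forall>x\<in>U. \<forall>y. y \<noteq> 0 \<longrightarrow> (\<forall>i j. hder_covec F (\<lambda>r. pdy r P) i j x y = hder_covec F (\<lambda>r. pdy r P) j i x y)) \<longleftrightarrow>
   (\<forall>x\<in>U. \<forall>y. y \<noteq> 0 \<longrightarrow> (\<forall>i j. Lie_tensor2 W (Sigma_curvature F) i j x y = 0))" (is "?C \<longleftrightarrow> ?Sigma")
  "(\<forall>x\<in>U. \<forall>y. y \<noteq> 0 \<longrightarrow> (\<forall>i j. Lie_tensor2 W (Sigma_curvature F) i j x y = 0)) \<longleftrightarrow>
   (\<forall>x\<in>U. \<forall>y. y \<noteq> 0 \<longrightarrow> (\<forall>i. Lie_covec W (Xi_curvature F) i x y = 0))" (is "_ \<longleftrightarrow> ?Xi")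
proof -
  have "hder_covec F (\<lambda>r. pdy r P) i j x y = hder_covec F (\<lambda>r. pdy r P) j i x y \<longleftrightarrow> hcurl F P i j x y = 0"
    if "x \<in> U" "y \<noteq> 0" for x y i j
    using hder_covec_curl[OF smooth_P that, of i j] by auto
  then show "?C \<longleftrightarrow> ?Sigma" by (simp add: Lie_Sigma)
  have n: "real CARD('n) + 1 \<noteq> 0" by linarith
  show "?Sigma \<longleftrightarrow> ?Xi"
  proof
    assume ?Sigma
    then show ?Xi by (simp add: Lie_Sigma Lie_Xi)
  next
    assume ?Xi
    then have "\<And>x y i. x \<in> U \<Longrightarrow> y \<noteq> 0 \<Longrightarrow> (\<Sum>m\<in>UNIV. y $ m * hcurl F P i m x y) = 0"
      using n by (simp add: Lie_Xi)
    from hcurl_zero_of_contraction_zero[OF this] show ?Sigma by (simp add: Lie_Sigma)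
  qed
qed

end

section \<open>The volume of an ellipsoid\<close>

lemma inner_symmetric_matrix:
  fixes A :: "real^'n^'n"
  assumes "transpose A = A"
  shows "u \<bullet> (A *v v) = v \<bullet> (A *v u)"
proof -
  have "u \<bullet> (A *v v) = (transpose A *v u) \<bullet> v"
    by (simp add: dot_lmul_matrix)
  then show ?thesis using assms by (simp add: inner_commute)
qed

lemma matrix_inv_works:
  fixes A :: "real^'n^'n"
  assumes "invertible A"
  shows "A ** matrix_inv A = mat 1" "matrix_inv A ** A = mat 1"
  using someI_ex[OF assms[unfolded invertible_def]] unfolding matrix_inv_def by blast+

text \<open>The Gram-Schmidt process for the inner product \<open>u \<bullet> (A v)\<close>, one vector at a time: a vector outside the span
of the vectors found so far is projected and normalized.\<close>

lemma posdef_orthonormal_set: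
  fixes A :: "real^'n^'n"
  assumes sym: "transpose A = A" and pos: "\<And>y. y \<noteq> 0 \<Longrightarrow> y \<bullet> (A *v y) > 0"
    and "k \<le> CARD('n)"
  shows "\<exists>S. finite S \<and> card S = k \<and> (\<forall>u\<in>S. \<forall>v\<in>S. u \<bullet> (A *v v) = (if u = v then 1 else 0))"
  using assms(3)
proof (induction k)
  case 0
  then show ?case by (intro exI[of _ "{}"]) simp
next
  case (Suc k)
  then obtain S where S: "finite S" "card S = k"
    "\<And>u v. u \<in> S \<Longrightarrow> v \<in> S \<Longrightarrow> u \<bullet> (A *v v) = (if u = v then 1 else 0)" by auto
  have "dim (span S) < CARD('n)"
    using dim_le_card[of S S] S Suc.prems by (simp add: span_superset)
  have "span S \<noteq> UNIV"
  proof
    assume "span S = UNIV"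
    then have "dim (span S) = CARD('n)" by (simp only: dim_UNIV DIM_cart DIM_real mult_1_right)
    then show False using \<open>dim (span S) < CARD('n)\<close> by linarith
  qed
  then obtain w where w: "w \<notin> span S" by auto
  define w' where "w' = w - (\<Sum>v\<in>S. (w \<bullet> (A *v v)) *\<^sub>R v)"
  have sp: "(\<Sum>v\<in>S. (w \<bullet> (A *v v)) *\<^sub>R v) \<in> span S"
    by (intro span_sum span_mul span_base)
  have w': "w' \<notin> span S"
  proof
    assume "w' \<in> span S"
    from span_add[OF this sp] w show False by (simp add: w'_def)
  qed
  then have "w' \<noteq> 0" using span_zero by metis
  then have q: "w' \<bullet> (A *v w') > 0" by (rule pos)
  have orth: "u \<bullet> (A *v w') = 0" if "u \<in> S" for u
  proof -
    have "u \<bullet> (A *v w') = u \<bullet> (A *v w) - (\<Sum>v\<in>S. (w \<bullet> (A *v v)) * (u \<bullet> (A *v v)))"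
      by (simp add: w'_def matrix_vector_mult_diff_distrib matrix_vector_mult_scaleR inner_diff_right
          linear_sum[OF matrix_vector_mul_linear] inner_sum_right)
    also have "(\<Sum>v\<in>S. (w \<bullet> (A *v v)) * (u \<bullet> (A *v v))) = (\<Sum>v\<in>S. if u = v then w \<bullet> (A *v v) else 0)"
      by (intro sum.cong refl) (use S(3) that in auto)
    also have "\<dots> = w \<bullet> (A *v u)" using S(1) that by simp
    finally show ?thesis using inner_symmetric_matrix[OF sym, of u w] by simp
  qed
  define n where "n = w' /\<^sub>R sqrt (w' \<bullet> (A *v w'))"
  have nn: "n \<bullet> (A *v n) = 1"
    using q by (simp add: n_def matrix_vector_mult_scaleR flip: power2_eq_square)
       (simp add: power2_eq_square field_simps)
  have on: "u \<bullet> (A *v n) = 0" "n \<bullet> (A *v u) = 0" if "u \<in> S" for u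
    using orth[OF that] inner_symmetric_matrix[OF sym, of n u]
    by (simp_all add: n_def matrix_vector_mult_scaleR)
  have nS: "n \<notin> S" using on nn by force
  show ?case
    by (intro exI[of _ "insert n S"]) (use S nS nn on in auto)
qed

lemma posdef_congruent_identity:
  fixes A :: "real^'n^'n"
  assumes sym: "transpose A = A" and pos: "\<And>y. y \<noteq> 0 \<Longrightarrow> y \<bullet> (A *v y) > 0"
  obtains E :: "real^'n^'n" where "transpose E ** A ** E = mat 1"
proof -
  obtain S where S: "finite S" "card S = CARD('n)"
    "\<And>u v. u \<in> S \<Longrightarrow> v \<in> S \<Longrightarrow> u \<bullet> (A *v v) = (if u = v then 1 else 0)"
    using posdef_orthonormal_set[OF assms, of "CARD('n)"] by auto
  obtain f :: "'n \<Rightarrow> real^'n" where f: "bij_betw f UNIV S"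
    using S by (metis finite_same_card_bij finite)
  define E :: "real^'n^'n" where "E = (\<chi> i j. f j $ i)"
  have "(transpose E ** (A ** E)) $ i $ j = f i \<bullet> (A *v f j)" for i j
    by (simp add: matrix_matrix_mult_def transpose_def E_def inner_vec_def matrix_vector_mult_def)
  moreover have "f i \<bullet> (A *v f j) = (if i = j then 1 else 0)" for i j
    using f S(3)[of "f i" "f j"] by (auto simp: bij_betw_def inj_on_def)
  ultimately have "transpose E ** A ** E = mat 1"
    by (simp add: vec_eq_iff mat_def matrix_mul_assoc)
  then show ?thesis by (rule that)
qed

lemma congruent_identity_inner:
  fixes A E :: "real^'n^'n"
  assumes E: "transpose E ** A ** E = mat 1"
  shows "(E *v z) \<bullet> (A *v (E *v z)) = z \<bullet> z"
proof -
  have "(E *v z) \<bullet> (A *v (E *v z)) = z \<bullet> (transpose E *v (A *v (E *v z)))"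
    using dot_lmul_matrix[of z "transpose E" "A *v (E *v z)"] by (simp only: vector_transpose_matrix)
  also have "\<dots> = z \<bullet> ((transpose E ** A ** E) *v z)"
    by (simp add: matrix_vector_mul_assoc matrix_mul_assoc)
  finally show ?thesis by (simp add: E)
qed

lemma posdef_invertible_congruence:
  fixes A E :: "real^'n^'n"
  assumes E: "transpose E ** A ** E = mat 1"
  shows "invertible E" "(det E)\<^sup>2 * det A = 1"
proof -
  have "det (transpose E ** A ** E) = 1" using E by simp
  then show d: "(det E)\<^sup>2 * det A = 1" by (simp add: det_mul power2_eq_square mult_ac)
  show "invertible E" using d by (auto simp: invertible_det_nz)
qed

text \<open>In orthonormal coordinates this is the Cauchy-Schwarz inequality.  It bounds the set whose supremum is the norm of a 1-form.\<close>

lemma posdef_linear_bound: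
  fixes A :: "real^'n^'n"
  assumes sym: "transpose A = A" and pos: "\<And>y. y \<noteq> 0 \<Longrightarrow> y \<bullet> (A *v y) > 0"
  shows "\<exists>B. \<forall>y. \<bar>b \<bullet> y\<bar> \<le> B * sqrt (y \<bullet> (A *v y))"
proof -
  obtain E :: "real^'n^'n" where E: "transpose E ** A ** E = mat 1"
    using posdef_congruent_identity[OF assms] by blast
  have "\<bar>b \<bullet> y\<bar> \<le> norm (transpose E *v b) * sqrt (y \<bullet> (A *v y))" for y
  proof -
    define z where "z = matrix_inv E *v y"
    have y: "y = E *v z"
      by (simp add: z_def matrix_vector_mul_assoc matrix_inv_works[OF posdef_invertible_congruence(1)[OF E]])
    have "b \<bullet> y = (transpose E *v b) \<bullet> z"
      unfolding y using dot_lmul_matrix[of b E z] by simp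
    moreover have "sqrt (y \<bullet> (A *v y)) = norm z"
      unfolding y congruent_identity_inner[OF E] by (simp add: norm_eq_sqrt_inner)
    ultimately show ?thesis using Cauchy_Schwarz_ineq2[of "transpose E *v b" z] by simp
  qed
  then show ?thesis by blast
qed

lemma posdef_det_pos:
  fixes A :: "real^'n^'n"
  assumes sym: "transpose A = A" and pos: "\<And>y. y \<noteq> 0 \<Longrightarrow> y \<bullet> (A *v y) > 0"
  shows "det A > 0"
proof -
  obtain E :: "real^'n^'n" where "transpose E ** A ** E = mat 1"
    using posdef_congruent_identity[OF assms] by blast
  from posdef_invertible_congruence(2)[OF this] show ?thesis using zero_less_mult_pos[of "(det E)\<^sup>2" "det A"] by (cases "det E = 0") auto
qed

text \<open>Completing the square turns the inequality into \<open>(y + c) \<bullet> A (y + c) < 1 + b \<bullet> c\<close>, and the substitution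
\<open>y + c = E z\<close> with \<open>E\<^sup>T A E = 1\<close> turns this into a ball of radius \<open>sqrt (1 + b \<bullet> c)\<close>.  The order on the index type
serves the transformation formula of Lebesgue measure under linear maps.\<close>

lemma ellipsoid_volume:
  fixes A :: "real^'n::{finite,wellorder}^'n::{finite,wellorder}"
  assumes sym: "transpose A = A" and pos: "\<And>y. y \<noteq> 0 \<Longrightarrow> y \<bullet> (A *v y) > 0" and c: "A *v c = b"
  shows "measure lebesgue {y. y \<bullet> (A *v y) + 2 * (b \<bullet> y) < 1}
    = sqrt (1 + b \<bullet> c) ^ CARD('n) / sqrt (det A) * measure lebesgue (ball (0::real^'n::{finite,wellorder}) 1)"
proof -
  obtain E :: "real^'n::{finite,wellorder}^'n::{finite,wellorder}" where E: "transpose E ** A ** E = mat 1"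
    using posdef_congruent_identity[OF sym pos] by blast
  note inv = posdef_invertible_congruence(1)[OF E] and dE = posdef_invertible_congruence(2)[OF E]
  from dE have "(det E)\<^sup>2 = 1 / det A" by (cases "det A = 0") (simp_all add: field_simps)
  then have "\<bar>det E\<bar> = sqrt (1 / det A)" by (metis real_sqrt_abs)
  then have absE: "\<bar>det E\<bar> = 1 / sqrt (det A)" by (simp add: real_sqrt_divide)
  have bc: "b \<bullet> c \<ge> 0"
    using pos[of c] c by (cases "c = 0") (auto simp: inner_commute less_imp_le)
  define r where "r = sqrt (1 + b \<bullet> c)"
  have r: "r \<ge> 0" "r\<^sup>2 = 1 + b \<bullet> c" using bc by (simp_all add: r_def)
  note q = congruent_identity_inner[OF E]
  have key: "y \<bullet> (A *v y) + 2 * (b \<bullet> y) < 1 \<longleftrightarrow> norm z < r" if "E *v z = y + c" for y z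
  proof -
    have "z \<bullet> z = y \<bullet> (A *v y) + 2 * (b \<bullet> y) + b \<bullet> c"
      using q[of z] inner_symmetric_matrix[OF sym, of y c] c unfolding that
      by (simp add: matrix_vector_right_distrib inner_add_left inner_add_right inner_commute)
    then have "(y \<bullet> (A *v y) + 2 * (b \<bullet> y) < 1) = ((norm z)\<^sup>2 < r\<^sup>2)"
      using r(2) by (auto simp: power2_norm_eq_inner)
    also have "\<dots> = (norm z < r)" using power2_less_imp_less[OF _ r(1), of "norm z"] power_strict_mono[of "norm z" r 2] by auto
    finally show ?thesis .
  qed
  have "{y. y \<bullet> (A *v y) + 2 * (b \<bullet> y) < 1} = (\<lambda>y. y - c) ` ((*v) E ` ball 0 r)" (is "?S = ?R")
  proof (intro set_eqI iffI)
    fix y assume y: "y \<in> ?S"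
    have Ez: "E *v (matrix_inv E *v (y + c)) = y + c"
      by (simp add: matrix_vector_mul_assoc matrix_inv_works[OF inv])
    then have "matrix_inv E *v (y + c) \<in> ball 0 r" using key[OF Ez] y by simp
    moreover have "y = E *v (matrix_inv E *v (y + c)) - c" by (simp add: Ez)
    ultimately show "y \<in> ?R" by blast
  next
    fix y assume "y \<in> ?R"
    then obtain z where "norm z < r" "y = E *v z - c" by auto
    then show "y \<in> ?S" using key[of z y] by simp
  qed
  then have "measure lebesgue ?S = measure lebesgue ((*v) E ` ball 0 r)"
    by (simp add: measure_translation_subtract)
  also have "\<dots> = \<bar>det E\<bar> * measure lebesgue (ball (0::real^'n::{finite,wellorder}) r)"
    using measure_linear_image[of "(*v) E" "ball 0 r"] by simp
  also have "measure lebesgue (ball (0::real^'n::{finite,wellorder}) r) = r ^ CARD('n) * measure lebesgue (ball (0::real^'n::{finite,wellorder}) 1)"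
    using content_ball[OF r(1), of "0::real^'n::{finite,wellorder}"] content_ball[of 1 "0::real^'n::{finite,wellorder}"] by simp
  finally show ?thesis unfolding absE by (simp add: r_def)
qed

section \<open>Ellipsoids in unordered coordinates\<close>

text \<open>A well-ordered copy of an arbitrary finite index type.  Renaming the coordinates along a bijection preserves
Lebesgue measure, which transfers the volume formula to index types without an order.\<close>

typedef 'n index = "{..<CARD('n::finite)}"
  by (rule exI[of _ 0]) simp

instantiation index :: (finite) linorder
begin
definition "i \<le> j \<longleftrightarrow> Rep_index i \<le> Rep_index j"
definition "i < j \<longleftrightarrow> Rep_index i < Rep_index j"
instance
  by standard (auto simp: less_eq_index_def less_index_def Rep_index_inject)
end

instance index :: (finite) wellorder
proof
  fix P :: "'a index \<Rightarrow> bool" and i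
  assume step: "\<And>i. (\<And>j. j < i \<Longrightarrow> P j) \<Longrightarrow> P i"
  show "P i"
  proof (induction i rule: measure_induct_rule[where f=Rep_index])
    case (less i)
    show ?case by (rule step, rule less.IH) (simp add: less_index_def)
  qed
qed

instance index :: (finite) finite
proof
  have "inj (Rep_index :: 'a index \<Rightarrow> nat)" by (simp add: inj_def Rep_index_inject)
  moreover have "range (Rep_index :: 'a index \<Rightarrow> nat) \<subseteq> {..<CARD('a)}" using Rep_index by auto
  ultimately show "finite (UNIV :: 'a index set)"
    by (meson finite_imageD finite_lessThan finite_subset)
qed

definition enum_index :: "'n::finite index \<Rightarrow> 'n" where
  "enum_index = (SOME h. bij h)"

lemma bij_enum_index: "bij (enum_index :: 'n::finite index \<Rightarrow> 'n)"
proof -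
  have "CARD('n index) = CARD('n)"
    using type_definition.card[OF type_definition_index[where 'n='n]] by simp
  then have "\<exists>h :: 'n index \<Rightarrow> 'n. bij h"
    by (rule finite_same_card_bij[rotated 2]) auto
  then show ?thesis unfolding enum_index_def by (rule someI_ex)
qed

lemma Basis_vec_real: "(Basis :: (real^'n) set) = (\<lambda>i. axis i 1) ` UNIV"
  by (auto simp: Basis_vec_def)

lemma prod_Basis_vec_real: "(\<Prod>b\<in>Basis. x \<bullet> b) = (\<Prod>i\<in>UNIV. (x :: real^'n) $ i)"
  unfolding Basis_vec_real by (subst prod.reindex) (auto simp: inj_def axis_eq_axis inner_axis)

text \<open>Renaming coordinates maps boxes to boxes with the same side lengths, and Lebesgue measure is determined by its
values on boxes.\<close>

lemma lborel_permute_coordinates: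
  fixes h :: "'m::finite \<Rightarrow> 'n::finite"
  assumes h: "bij h"
  shows "distr lborel borel (\<lambda>x :: real^'n. \<chi> i. x $ h i) = (lborel :: (real^'m) measure)"
proof (rule lborel_eqI[symmetric])
  have cont: "continuous_on UNIV (\<lambda>x :: real^'n. \<chi> i. x $ h i)"
    by (intro continuous_intros)
  then have meas [measurable]: "(\<lambda>x :: real^'n. \<chi> i. x $ h i) \<in> borel_measurable borel"
    by (rule borel_measurable_continuous_onI)
  fix l u :: "real^'m"
  assume lu: "\<And>b. b \<in> Basis \<Longrightarrow> l \<bullet> b \<le> u \<bullet> b"
  then have lu': "l $ i \<le> u $ i" for i
    using lu[of "axis i 1"] by (auto simp: Basis_vec_real inner_axis)
  define l' u' :: "real^'n" where "l' = (\<chi> i. l $ inv h i)" and "u' = (\<chi> i. u $ inv h i)"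
  have "(\<lambda>x :: real^'n. \<chi> i. x $ h i) -` box l u = box l' u'"
    using h by (auto simp: mem_box_cart l'_def u'_def bij_is_surj bij_is_inj)
      (metis bij_inv_eq_iff h)+
  then have "emeasure (distr lborel borel (\<lambda>x :: real^'n. \<chi> i. x $ h i)) (box l u)
    = emeasure lborel (box l' u')"
    by (subst emeasure_distr) auto
  also have "\<dots> = (\<Prod>b\<in>Basis. (u' - l') \<bullet> b)"
    by (rule emeasure_lborel_box) (auto simp: Basis_vec_real inner_axis l'_def u'_def lu')
  also have "(\<Prod>b\<in>Basis. (u' - l') \<bullet> b) = (\<Prod>b\<in>Basis. (u - l) \<bullet> b)"
    unfolding prod_Basis_vec_real
    using prod.reindex_bij_betw[OF bij_imp_bij_inv[OF h], of "\<lambda>i. (u - l) $ i"]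
    by (simp add: l'_def u'_def)
  finally show "emeasure (distr lborel borel (\<lambda>x :: real^'n. \<chi> i. x $ h i)) (box l u) = (\<Prod>b\<in>Basis. (u - l) \<bullet> b)" .
qed simp

definition index_matrix :: "real^'n::finite^'n \<Rightarrow> real^('n index)^('n index)" where
  "index_matrix A = (\<chi> i j. A $ enum_index i $ enum_index j)"

definition index_vector :: "real^'n::finite \<Rightarrow> real^('n index)" where
  "index_vector v = (\<chi> i. v $ enum_index i)"

lemma sum_enum_index: "(\<Sum>i\<in>UNIV. f (enum_index i)) = (\<Sum>i\<in>UNIV. f i)"
  by (rule sum.reindex_bij_betw[OF bij_enum_index])

lemma index_vector_inner: "index_vector u \<bullet> index_vector v = u \<bullet> v"
  using sum_enum_index[of "\<lambda>i. u $ i * v $ i"] by (simp add: index_vector_def inner_vec_def)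

lemma index_matrix_vector: "index_matrix A *v index_vector v = index_vector (A *v v)"
  using sum_enum_index[of "\<lambda>j. A $ enum_index i $ j * v $ j" for i]
  by (simp add: index_vector_def index_matrix_def matrix_vector_mult_def vec_eq_iff)

lemma index_vector_surj: "\<exists>v. index_vector v = z"
proof
  show "index_vector (\<chi> i. z $ inv enum_index i) = z"
    by (simp add: index_vector_def vec_eq_iff bij_is_inj[OF bij_enum_index])
qed

lemma index_vector_eq_0: "index_vector v = 0 \<longleftrightarrow> v = 0"
  using index_vector_inner[of v v] by (metis inner_eq_zero_iff)

lemma index_matrix_posdef:
  fixes A :: "real^'n::finite^'n"
  assumes "transpose A = A" and "\<And>y. y \<noteq> 0 \<Longrightarrow> y \<bullet> (A *v y) > 0"
  shows "transpose (index_matrix A) = index_matrix A"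
    and "z \<noteq> 0 \<Longrightarrow> z \<bullet> (index_matrix A *v z) > 0"
proof -
  show "transpose (index_matrix A) = index_matrix A"
    using assms(1) by (simp add: index_matrix_def transpose_def vec_eq_iff)
  assume "z \<noteq> 0"
  then obtain v where "z = index_vector v" "v \<noteq> 0" using index_vector_surj[of z] index_vector_eq_0 by metis
  then show "z \<bullet> (index_matrix A *v z) > 0"
    by (simp add: index_matrix_vector index_vector_inner assms(2))
qed

text \<open>The determinant and the centre stay in the renamed coordinates: only their smooth dependence on
\<open>A\<close> and \<open>b\<close> matters later, and it is visible in any coordinates.\<close>

lemma ellipsoid_volume_index:
  fixes A :: "real^'n::finite^'n"
  assumes "transpose A = A" and "\<And>y. y \<noteq> 0 \<Longrightarrow> y \<bullet> (A *v y) > 0"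
    and c: "index_matrix A *v c = index_vector b"
  shows "measure lborel {y. y \<bullet> (A *v y) + 2 * (b \<bullet> y) < 1}
    = sqrt (1 + index_vector b \<bullet> c) ^ CARD('n index) / sqrt (det (index_matrix A))
      * measure lborel (ball (0::real^('n index)) 1)"
proof -
  let ?T = "\<lambda>x :: real^'n. (\<chi> i. x $ enum_index i) :: real^('n index)"
  let ?S = "{z. z \<bullet> (index_matrix A *v z) + 2 * (index_vector b \<bullet> z) < 1}"
  have op: "open ?S"
    by (intro open_Collect_less continuous_intros matrix_vector_mult_linear_continuous_on)
  have meas: "?T \<in> borel_measurable borel"
    by (intro borel_measurable_continuous_onI continuous_intros)
  have pre: "?T -` ?S = {y. y \<bullet> (A *v y) + 2 * (b \<bullet> y) < 1}"
    unfolding index_vector_def[symmetric] by (auto simp: index_matrix_vector index_vector_inner)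
  have "measure lborel ?S = measure (distr lborel borel ?T) ?S"
    by (subst lborel_permute_coordinates[OF bij_enum_index]) simp
  also have "\<dots> = measure lborel (?T -` ?S)"
    using op meas by (subst measure_distr) auto
  finally have "measure lborel {y. y \<bullet> (A *v y) + 2 * (b \<bullet> y) < 1} = measure lebesgue ?S"
    unfolding pre using op by simp
  also have "\<dots> = sqrt (1 + index_vector b \<bullet> c) ^ CARD('n index) / sqrt (det (index_matrix A))
      * measure lebesgue (ball (0::real^('n index)) 1)"
    using ellipsoid_volume[OF index_matrix_posdef(1)[OF assms(1,2)] index_matrix_posdef(2)[OF assms(1,2)] c] .
  finally show ?thesis by simp
qed

section \<open>Smoothness of determinants and inverse matrices\<close>

lemma smooth_on_det:
  fixes m :: "'a::real_normed_vector \<Rightarrow> real^'n^'n"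
  assumes "open S" "\<And>i j. smooth_on S (\<lambda>z. m z $ i $ j)"
  shows "smooth_on S (\<lambda>z. det (m z))"
  unfolding det_def
  by (intro smooth_on_sum smooth_on_mult smooth_on_const smooth_on_prod assms)

text \<open>By Cramer's rule the entries of the inverse are quotients of determinants.\<close>

lemma smooth_on_matrix_inv:
  fixes m :: "'a::real_normed_vector \<Rightarrow> real^'n^'n"
  assumes S: "open S" and m: "\<And>i j. smooth_on S (\<lambda>z. m z $ i $ j)"
    and det: "\<And>z. z \<in> S \<Longrightarrow> det (m z) \<noteq> 0"
  shows "smooth_on S (\<lambda>z. matrix_inv (m z) $ i $ h)"
proof -
  let ?C = "\<lambda>z. (\<chi> k j. if j = i then axis h 1 $ k else m z $ k $ j) :: real^'n^'n"
  have "smooth_on S (\<lambda>z. det (?C z) / det (m z))"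
  proof (intro smooth_on_divide smooth_on_det S m det)
    fix k j
    show "smooth_on S (\<lambda>z. ?C z $ k $ j)"
      by (cases "j = i") (simp_all add: m smooth_on_const)
  qed
  moreover have "det (?C z) / det (m z) = matrix_inv (m z) $ i $ h" if "z \<in> S" for z
  proof -
    have "invertible (m z)" using det[OF that] by (simp add: invertible_det_nz)
    then have "m z *v (matrix_inv (m z) *v axis h 1) = axis h 1"
      by (simp add: matrix_vector_mul_assoc matrix_inv_works)
    then have "matrix_inv (m z) *v axis h 1 = (\<chi> i. det (\<chi> k j. if j = i then axis h 1 $ k else m z $ k $ j) / det (m z))"
      using cramer[OF det[OF that]] by blast
    then have "(matrix_inv (m z) *v axis h 1) $ i = det (?C z) / det (m z)"
      by simp
    then show ?thesis by (simp add: matrix_vector_mul_component inner_axis)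
  qed
  ultimately show ?thesis by (rule smooth_on_cong[OF _ S])
qed

section \<open>Homogeneous functions on the slit tangent bundle\<close>

context coordinate_domain
begin

definition homogeneous :: "nat \<Rightarrow> 'n tmfun \<Rightarrow> bool" where
  "homogeneous d f \<longleftrightarrow> (\<forall>x\<in>U. \<forall>y. y \<noteq> 0 \<longrightarrow> (\<forall>t>0. f x (t *\<^sub>R y) = t ^ d * f x y))"

lemma homogeneousD:
  "homogeneous d f \<Longrightarrow> x \<in> U \<Longrightarrow> y \<noteq> 0 \<Longrightarrow> t > 0 \<Longrightarrow> f x (t *\<^sub>R y) = t ^ d * f x y"
  by (simp add: homogeneous_def)

lemma pdy_scale:
  assumes f: "sm f" and xy: "x \<in> U" "y \<noteq> 0" and t: "t \<noteq> 0"
  shows "pdy k (\<lambda>x y. f x (t *\<^sub>R y)) x y = t * pdy k f x (t *\<^sub>R y)"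
proof -
  have "((\<lambda>r. f x (t *\<^sub>R y + r *\<^sub>R axis k 1)) has_real_derivative pdy k f x (t *\<^sub>R y)) (at (t * 0))"
    using pdy_DERIV[OF f, of x "t *\<^sub>R y" k] xy t by simp
  from DERIV_chain2[where g="\<lambda>r. t * r" and Db=t and s=UNIV and x=0, OF this]
  have "((\<lambda>r. f x (t *\<^sub>R y + (t * r) *\<^sub>R axis k 1)) has_real_derivative pdy k f x (t *\<^sub>R y) * t) (at 0)"
    by (auto intro!: derivative_eq_intros)
  then show ?thesis
    unfolding pdy_def by (intro DERIV_imp_deriv) (simp add: scaleR_add_right mult.commute)
qed

lemma homogeneous_pdy:
  assumes f: "sm f" and h: "homogeneous (Suc d) f"
  shows "homogeneous d (pdy k f)"
  unfolding homogeneous_def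
proof (intro ballI allI impI)
  fix x y :: "real^'n" and t :: real assume xy: "x \<in> U" "y \<noteq> 0" and t: "t > 0"
  have "pdy k (\<lambda>x y. f x (t *\<^sub>R y)) x y = pdy k (\<lambda>x y. t ^ Suc d * f x y) x y"
    by (rule pdy_cong[OF xy homogeneousD[OF h _ _ t]])
  then have "t * pdy k f x (t *\<^sub>R y) = t ^ Suc d * pdy k f x y"
    using f xy t by (simp add: pdy_scale pdy_mult)
  then show "pdy k f x (t *\<^sub>R y) = t ^ d * pdy k f x y" using t by simp
qed

lemma homogeneous_pdx:
  assumes f: "sm f" and h: "homogeneous d f"
  shows "homogeneous d (pdx k f)"
  unfolding homogeneous_def
proof (intro ballI allI impI)
  fix x y :: "real^'n" and t :: real assume xy: "x \<in> U" "y \<noteq> 0" and t: "t > 0"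
  have "pdx k (\<lambda>x y. f x (t *\<^sub>R y)) x y = pdx k (\<lambda>x y. t ^ d * f x y) x y"
    by (rule pdx_cong[OF xy homogeneousD[OF h _ _ t]])
  then show "pdx k f x (t *\<^sub>R y) = t ^ d * pdx k f x y"
    using f xy by (simp add: pdx_mult) (simp add: pdx_def)
qed

text \<open>Both sides are the derivative of \<open>t \<mapsto> f x ((1 + t) y)\<close> at \<open>t = 0\<close>.\<close>

lemma euler_homogeneous:
  assumes f: "sm f" and h: "homogeneous d f" and xy: "x \<in> U" "y \<noteq> 0"
  shows "(\<Sum>j\<in>UNIV. y $ j * pdy j f x y) = real d * f x y"
proof -
  let ?D = "frechet_derivative (\<lambda>z. f (fst z) (snd z)) (at (x, y))"
  have lin: "linear ?D"
    using smooth_on_has_derivative[of "U \<times> - {0}"] f xy unfolding smooth_tm_def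
    by (intro has_derivative_linear) auto
  have "(0, y) = (\<Sum>j\<in>UNIV. y $ j *\<^sub>R (0 :: real^'n, axis j (1::real)))"
    by (simp add: prod_eq_iff fst_sum snd_sum vec_eq_iff axis_def if_distrib cong: if_cong)
  then have "?D (0, y) = (\<Sum>j\<in>UNIV. y $ j * ?D (0, axis j 1))"
    by (simp add: linear_sum[OF lin] linear_cmul[OF lin] del: scaleR_Pair)
  also have "\<dots> = (\<Sum>j\<in>UNIV. y $ j * pdy j f x y)"
    by (simp add: pdy_frechet[OF f xy])
  finally have "((\<lambda>t. f x (y + t *\<^sub>R y)) has_real_derivative (\<Sum>j\<in>UNIV. y $ j * pdy j f x y)) (at 0)"
    using pd_DERIV[OF f xy, of 0 y] by simp
  moreover have "((\<lambda>t. f x (y + t *\<^sub>R y)) has_real_derivative real d * f x y) (at 0)"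
  proof (rule has_field_derivative_transform_within_open[of "\<lambda>t. (1 + t) ^ d * f x y" _ _ "{-1<..}"])
    show "((\<lambda>t. (1 + t) ^ d * f x y) has_real_derivative real d * f x y) (at 0)"
      by (auto intro!: derivative_eq_intros)
    show "(1 + t) ^ d * f x y = f x (y + t *\<^sub>R y)" if "t \<in> {-1<..}" for t
      using homogeneousD[OF h xy, of "1 + t"] that by (simp add: scaleR_add_left)
  qed auto
  ultimately show ?thesis by (rule DERIV_unique)
qed

text \<open>The inverse of the fundamental tensor has degree 0, and every term it is multiplied with has degree 2.\<close>

lemma homogeneous_spray:
  assumes sF: "sm (sq F)" and hF: "homogeneous 2 (sq F)"
  shows "homogeneous 2 (spray F i)"
  unfolding homogeneous_def
proof (intro ballI allI impI)
  fix x y :: "real^'n" and t :: real assume xy: "x \<in> U" "y \<noteq> 0" and t: "t > 0"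
  have h1: "homogeneous (Suc (Suc 0)) (sq F)" using hF by (simp add: numeral_2_eq_2)
  have "homogeneous 0 (pdy j (pdy i (sq F)))" for i j
    by (intro homogeneous_pdy h1 sF sm_pdy)
  from homogeneousD[OF this xy t] have "fundamental_tensor F x (t *\<^sub>R y) = fundamental_tensor F x y"
    by (simp add: fundamental_tensor_def)
  moreover have "pdx h (sq F) x (t *\<^sub>R y) = t\<^sup>2 * pdx h (sq F) x y" for h
    by (intro homogeneousD[OF homogeneous_pdx[OF sF hF] xy t])
  moreover have "homogeneous 1 (pdy h (pdx k (sq F)))" for h k
    using homogeneous_pdy[OF sm_pdx[OF sF] homogeneous_pdx[OF sF h1]] by simp
  from homogeneousD[OF this xy t]
  have "pdy h (pdx k (sq F)) x (t *\<^sub>R y) = t * pdy h (pdx k (sq F)) x y" for h k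
    by simp
  ultimately show "spray F i x (t *\<^sub>R y) = t\<^sup>2 * spray F i x y"
    by (simp add: spray_def power2_eq_square sum_distrib_left right_diff_distrib mult_ac)
qed

lemma smooth_spray_of_det:
  assumes sF: "sm (sq F)" and det: "\<And>x y. x \<in> U \<Longrightarrow> y \<noteq> 0 \<Longrightarrow> det (fundamental_tensor F x y) \<noteq> 0"
  shows "sm (spray F i)"
proof -
  have "smooth_on (U \<times> - {0}) (\<lambda>z. matrix_inv (fundamental_tensor F (fst z) (snd z)) $ i $ h)" for h
  proof (rule smooth_on_matrix_inv[OF open_slit])
    fix i j
    have "sm (\<lambda>x y. 1/2 * pdy j (pdy i (sq F)) x y)" using sF by simp
    then show "smooth_on (U \<times> - {0}) (\<lambda>z. fundamental_tensor F (fst z) (snd z) $ i $ j)"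
      by (simp add: smooth_tm_def fundamental_tensor_def)
  qed (use det in \<open>simp add: mem_Times_iff\<close>)
  then have "sm (\<lambda>x y. matrix_inv (fundamental_tensor F x y) $ i $ h)" for h
    by (simp add: smooth_tm_def)
  moreover have "spray F i = (\<lambda>x y. 1/4 * (\<Sum>h\<in>UNIV. matrix_inv (fundamental_tensor F x y) $ i $ h *
     ((\<Sum>k\<in>UNIV. y $ k * pdy h (pdx k (sq F)) x y) - pdx h (sq F) x y)))"
    by (intro ext) (simp add: spray_def)
  ultimately show ?thesis using sF by simp
qed

text \<open>The projective factor inherits smoothness and homogeneity from the spray, because it can be solved for:
\<open>P = (\<Sum>\<^sub>i y\<^sup>i \<L>\<^sub>i) / |y|\<^sup>2\<close> with \<open>\<L>\<^sub>i\<close> the Lie derivative of the spray.\<close>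

lemma projective_field_on_of_spray:
  assumes G: "\<And>i. sm (spray F i)" "\<And>i. homogeneous 2 (spray F i)"
    and W: "smooth_on U W"
    and density: "smooth_on U (\<lambda>x. ln (BH_density F x))"
    and proj: "\<And>x y i. x \<in> U \<Longrightarrow> y \<noteq> 0 \<Longrightarrow> Lie_spray W (spray F) i x y = P x y * y $ i"
  shows "projective_field_on U F P W"
proof -
  have w: "sm (vf_comp W i)" for i
    using sm_base[OF smooth_on_vec_nth[OF open_U W]] by (simp add: vf_comp_def[abs_def])
  have L: "Lie_spray W (spray F) i = (\<lambda>x y. (\<Sum>j\<in>UNIV. vf_comp W j x y * pdx j (spray F i) x y) +
     (\<Sum>j\<in>UNIV. \<Sum>k\<in>UNIV. y $ k * pdx k (vf_comp W j) x y * pdy j (spray F i) x y)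
     - (\<Sum>k\<in>UNIV. spray F k x y * pdx k (vf_comp W i) x y) +
    1/2 * (\<Sum>j\<in>UNIV. \<Sum>k\<in>UNIV. y $ j * y $ k * pdx k (pdx j (vf_comp W i)) x y))" for i
    by (intro ext) (simp add: Lie_spray_def complete_lift_def vf_comp_def)
  have smL: "sm (Lie_spray W (spray F) i)" for i
    unfolding L using w G by simp
  have homL: "homogeneous 2 (Lie_spray W (spray F) i)" for i
    unfolding homogeneous_def
  proof (intro ballI allI impI)
    fix x y :: "real^'n" and t :: real assume xy: "x \<in> U" "y \<noteq> 0" and t: "t > 0"
    have b: "vf_comp W j x (t *\<^sub>R y) = vf_comp W j x y"
      "pdx k (vf_comp W j) x (t *\<^sub>R y) = pdx k (vf_comp W j) x y"
      "pdx l (pdx k (vf_comp W j)) x (t *\<^sub>R y) = pdx l (pdx k (vf_comp W j)) x y" for j k l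
      using basic_vf_comp[of W j] basic_pdx[OF basic_vf_comp[of W j], of k]
        basic_pdx[OF basic_pdx[OF basic_vf_comp[of W j], of k], of l]
      unfolding basic_def by blast+
    have h1: "homogeneous (Suc 1) (spray F i)" for i using G(2)[of i] by (simp add: numeral_2_eq_2)
    have "pdy j (spray F i) x (t *\<^sub>R y) = t * pdy j (spray F i) x y" for j
      using homogeneousD[OF homogeneous_pdy[OF G(1) h1] xy t] by simp
    moreover have "pdx j (spray F i) x (t *\<^sub>R y) = t\<^sup>2 * pdx j (spray F i) x y" for j
      by (rule homogeneousD[OF homogeneous_pdx[OF G] xy t])
    moreover have "spray F k x (t *\<^sub>R y) = t\<^sup>2 * spray F k x y" for k
      by (rule homogeneousD[OF G(2) xy t])
    ultimately show "Lie_spray W (spray F) i x (t *\<^sub>R y) = t\<^sup>2 * Lie_spray W (spray F) i x y"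
      unfolding L b
      by (simp add: distrib_left right_diff_distrib sum_distrib_left power2_eq_square mult_ac)
  qed
  have smP: "sm P"
  proof (rule sm_cong)
    show "sm (\<lambda>x y. (\<Sum>i\<in>UNIV. y $ i * Lie_spray W (spray F) i x y) / (\<Sum>i\<in>UNIV. y $ i * y $ i))"
    proof (rule sm_divide)
      show "(\<Sum>i\<in>UNIV. y $ i * y $ i) \<noteq> 0" if "y \<noteq> 0" for y :: "real^'n"
        using that by (metis inner_eq_zero_iff inner_vec_def inner_real_def)
    qed (simp_all add: smL)
    fix x y :: "real^'n" assume xy: "x \<in> U" "y \<noteq> 0"
    then have "(\<Sum>i\<in>UNIV. y $ i * y $ i) \<noteq> 0"
      by (metis inner_eq_zero_iff inner_vec_def inner_real_def)
    then show "(\<Sum>i\<in>UNIV. y $ i * Lie_spray W (spray F) i x y) / (\<Sum>i\<in>UNIV. y $ i * y $ i) = P x y"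
      using proj[OF xy] by (simp add: sum_distrib_left[symmetric] mult_ac divide_simps)
        (simp add: sum_distrib_left mult_ac)
  qed
  have homP: "homogeneous 1 P"
    unfolding homogeneous_def
  proof (intro ballI allI impI)
    fix x y :: "real^'n" and t :: real assume xy: "x \<in> U" "y \<noteq> 0" and t: "t > 0"
    from xy(2) obtain i where i: "y $ i \<noteq> 0" by (auto simp: vec_eq_iff)
    have "P x (t *\<^sub>R y) * (t * y $ i) = t\<^sup>2 * (P x y * y $ i)"
      using homogeneousD[OF homL xy t, of i] proj[OF xy, of i] proj[of x "t *\<^sub>R y" i] xy t by simp
    then show "P x (t *\<^sub>R y) = t ^ 1 * P x y"
      using i t by (simp add: power2_eq_square)
  qed
  show ?thesis
  proof
    show "(\<Sum>j\<in>UNIV. y $ j * pdy j (spray F i) x y) = 2 * spray F i x y"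
      if "x \<in> U" "y \<noteq> 0" for x y i
      using euler_homogeneous[OF G that] by simp
    show "(\<Sum>j\<in>UNIV. y $ j * pdy j P x y) = P x y" if "x \<in> U" "y \<noteq> 0" for x y
      using euler_homogeneous[OF smP homP that] by simp
  qed (use G W smP density proj in auto)
qed

end

section \<open>Randers metrics in coordinates\<close>

locale randers_chart = coordinate_domain U for U :: "(real^'n::finite) set" +
  fixes F :: "'n tmfun" and g :: "real^'n \<Rightarrow> real^'n^'n" and b :: "real^'n \<Rightarrow> real^'n"
  assumes smooth_g: "smooth_on U g" and smooth_b: "smooth_on U b"
    and sym_g: "x \<in> U \<Longrightarrow> transpose (g x) = g x"
    and pos_g: "x \<in> U \<Longrightarrow> y \<noteq> 0 \<Longrightarrow> y \<bullet> (g x *v y) > 0"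
    and bound_b: "x \<in> U \<Longrightarrow> y \<noteq> 0 \<Longrightarrow> \<bar>b x \<bullet> y\<bar> < sqrt (y \<bullet> (g x *v y))"
    and F: "x \<in> U \<Longrightarrow> F x y = sqrt (y \<bullet> (g x *v y)) + b x \<bullet> y"
begin

definition q :: "'n tmfun" where "q x y = y \<bullet> (g x *v y)"
definition \<alpha> :: "'n tmfun" where "\<alpha> x y = sqrt (q x y)"
definition \<beta> :: "'n tmfun" where "\<beta> x y = b x \<bullet> y"
definition flat :: "'n \<Rightarrow> 'n tmfun" where "flat i x y = (g x *v y) $ i"

lemma smooth_g_comp [simp]: "sm (\<lambda>x y. g x $ i $ j)"
  by (intro sm_base smooth_on_vec_nth open_U smooth_g)

lemma smooth_b_comp [simp]: "sm (\<lambda>x y. b x $ i)"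
  by (intro sm_base smooth_on_vec_nth open_U smooth_b)

lemma flat_unfold: "flat i = (\<lambda>x y. \<Sum>j\<in>UNIV. g x $ i $ j * y $ j)"
  by (intro ext) (simp add: flat_def matrix_vector_mult_def)

lemma q_unfold: "q = (\<lambda>x y. \<Sum>i\<in>UNIV. y $ i * flat i x y)"
  by (intro ext) (simp add: q_def flat_def inner_vec_def)

lemma \<beta>_unfold: "\<beta> = (\<lambda>x y. \<Sum>i\<in>UNIV. b x $ i * y $ i)"
  by (intro ext) (simp add: \<beta>_def inner_vec_def)

lemma smooth_flat [simp]: "sm (flat i)"
  unfolding flat_unfold by simp

lemma smooth_q [simp]: "sm q"
  unfolding q_unfold by simp

lemma smooth_beta [simp]: "sm \<beta>"
  unfolding \<beta>_unfold by simp

lemma smooth_alpha [simp]: "sm \<alpha>"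
  unfolding \<alpha>_def[abs_def] by (rule sm_sqrt[OF smooth_q]) (simp add: pos_g q_def)

context
  fixes x y :: "real^'n"
  assumes xy: "x \<in> U" "y \<noteq> 0"
begin

lemma alpha_pos: "\<alpha> x y > 0"
  using pos_g[OF xy] by (simp add: \<alpha>_def q_def)

lemma alpha_square: "\<alpha> x y * \<alpha> x y = q x y"
  using pos_g[OF xy] by (simp add: \<alpha>_def q_def)

lemma F_pos: "\<alpha> x y + \<beta> x y > 0"
  using bound_b[OF xy] by (simp add: \<alpha>_def \<beta>_def q_def)

lemma pdy_beta: "pdy i \<beta> x y = b x $ i"
  unfolding \<beta>_unfold using xy by (simp add: pdy_sum pdy_mult pdy_basic if_zero_mult)

lemma pdy_flat: "pdy j (flat i) x y = g x $ i $ j"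
  unfolding flat_unfold using xy by (simp add: pdy_sum pdy_mult pdy_basic if_zero_mult)

lemma pdy_q: "pdy i q x y = 2 * flat i x y"
proof -
  have "g x $ k $ i = g x $ i $ k" for k
    using arg_cong[OF sym_g[OF xy(1)], of "\<lambda>m. m $ i $ k"] by (simp add: transpose_def)
  then have "(\<Sum>k\<in>UNIV. y $ k * g x $ k $ i) = flat i x y"
    by (simp add: flat_unfold mult.commute)
  moreover have "pdy i q x y = flat i x y + (\<Sum>k\<in>UNIV. y $ k * g x $ k $ i)"
    unfolding q_unfold using xy
    by (simp add: pdy_sum pdy_mult if_zero_mult sum.distrib pdy_flat)
  ultimately show ?thesis by simp
qed

end

lemma alpha_pdy_alpha:
  assumes xy: "x \<in> U" "y \<noteq> 0"
  shows "\<alpha> x y * pdy i \<alpha> x y = flat i x y"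
proof -
  have "pdy i (\<lambda>x y. \<alpha> x y * \<alpha> x y) x y = pdy i q x y"
    by (rule pdy_cong[OF xy alpha_square])
  then show ?thesis using xy by (simp add: pdy_mult pdy_q)
qed

lemma alpha_pdy_pdy_alpha:
  assumes xy: "x \<in> U" "y \<noteq> 0"
  shows "\<alpha> x y * pdy j (pdy i \<alpha>) x y = g x $ i $ j - pdy j \<alpha> x y * pdy i \<alpha> x y"
proof -
  have "pdy j (\<lambda>x y. \<alpha> x y * pdy i \<alpha> x y) x y = pdy j (flat i) x y"
    by (rule pdy_cong[OF xy alpha_pdy_alpha])
  then show ?thesis using xy by (simp add: pdy_mult pdy_flat)
qed

lemma sq_F: "x \<in> U \<Longrightarrow> y \<noteq> 0 \<Longrightarrow> sq F x y = (\<alpha> x y + \<beta> x y) * (\<alpha> x y + \<beta> x y)"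
  by (simp add: sq_def F \<alpha>_def \<beta>_def q_def power2_eq_square)

lemma smooth_sq_F [simp]: "sm (sq F)"
  by (rule sm_cong[of "\<lambda>x y. (\<alpha> x y + \<beta> x y) * (\<alpha> x y + \<beta> x y)"]) (simp_all add: sq_F)

lemma fundamental_tensor_randers:
  assumes xy: "x \<in> U" "y \<noteq> 0"
  shows "fundamental_tensor F x y $ i $ j = (pdy i \<alpha> x y + b x $ i) * (pdy j \<alpha> x y + b x $ j)
    + (\<alpha> x y + \<beta> x y) * pdy j (pdy i \<alpha>) x y"
proof -
  have 1: "pdy i (sq F) x y = 2 * ((\<alpha> x y + \<beta> x y) * (pdy i \<alpha> x y + b x $ i))"
    if xy: "x \<in> U" "y \<noteq> 0" for x y
  proof -
    have "pdy i (sq F) x y = pdy i (\<lambda>x y. (\<alpha> x y + \<beta> x y) * (\<alpha> x y + \<beta> x y)) x y"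
      by (rule pdy_cong[OF xy sq_F])
    then show ?thesis using xy by (simp add: pdy_mult pdy_add pdy_beta algebra_simps)
  qed
  have "pdy j (pdy i (sq F)) x y = pdy j (\<lambda>x y. 2 * ((\<alpha> x y + \<beta> x y) * (pdy i \<alpha> x y + b x $ i))) x y"
    by (rule pdy_cong[OF xy 1])
  also have "\<dots> = 2 * ((pdy j \<alpha> x y + b x $ j) * (pdy i \<alpha> x y + b x $ i) + (\<alpha> x y + \<beta> x y) * pdy j (pdy i \<alpha>) x y)"
    using xy by (simp add: pdy_mult pdy_add pdy_beta pdy_basic)
  finally show ?thesis by (simp add: fundamental_tensor_def)
qed

text \<open>Writing \<open>F\<^sub>i\<close> for the vertical derivatives, the fundamental tensor evaluated at \<open>(v, v)\<close> is \<open>(F\<^sub>i v\<^sup>i)\<^sup>2 + F \<alpha>\<^sub>i\<^sub>j v\<^sup>i v\<^sup>j\<close>, where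
\<open>\<alpha> \<alpha>\<^sub>i\<^sub>j v\<^sup>i v\<^sup>j\<close> is the squared length of the component \<open>v - t y\<close> of \<open>v\<close> orthogonal to \<open>y\<close>.  Both
summands are nonnegative.  If they vanish, then \<open>v = t y\<close> and \<open>t F = F\<^sub>i v\<^sup>i = 0\<close>.\<close>

lemma fundamental_tensor_kernel:
  assumes xy: "x \<in> U" "y \<noteq> 0" and v: "fundamental_tensor F x y *v v = 0"
  shows "v = 0"
proof -
  let ?a = "\<Sum>i\<in>UNIV. pdy i \<alpha> x y * v $ i" and ?s = "\<Sum>i\<in>UNIV. (pdy i \<alpha> x y + b x $ i) * v $ i"
  let ?f = "\<alpha> x y + \<beta> x y"
  let ?h = "\<Sum>i\<in>UNIV. \<Sum>j\<in>UNIV. v $ i * (pdy j (pdy i \<alpha>) x y * v $ j)"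
  have "0 = v \<bullet> (fundamental_tensor F x y *v v)" using v by simp
  also have "\<dots> = (\<Sum>i\<in>UNIV. \<Sum>j\<in>UNIV. (pdy i \<alpha> x y + b x $ i) * v $ i * ((pdy j \<alpha> x y + b x $ j) * v $ j))
      + ?f * ?h"
    by (simp add: inner_vec_def matrix_vector_mult_def fundamental_tensor_randers[OF xy]
        sum_distrib_left sum.distrib algebra_simps)
  also have "(\<Sum>i\<in>UNIV. \<Sum>j\<in>UNIV. (pdy i \<alpha> x y + b x $ i) * v $ i * ((pdy j \<alpha> x y + b x $ j) * v $ j)) = ?s * ?s"
    by (rule sum_product[symmetric])
  finally have 1: "?s * ?s + ?f * ?h = 0" by simp
  have ah: "\<alpha> x y * ?h = v \<bullet> (g x *v v) - ?a * ?a"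
  proof -
    have "\<alpha> x y * ?h = (\<Sum>i\<in>UNIV. \<Sum>j\<in>UNIV. v $ i * (\<alpha> x y * pdy j (pdy i \<alpha>) x y * v $ j))"
      by (simp add: sum_distrib_left mult_ac)
    also have "\<dots> = (\<Sum>i\<in>UNIV. \<Sum>j\<in>UNIV. v $ i * (g x $ i $ j * v $ j))
        - (\<Sum>i\<in>UNIV. \<Sum>j\<in>UNIV. pdy i \<alpha> x y * v $ i * (pdy j \<alpha> x y * v $ j))"
      unfolding alpha_pdy_pdy_alpha[OF xy]
      by (simp add: sum_subtractf algebra_simps)
    also have "(\<Sum>i\<in>UNIV. \<Sum>j\<in>UNIV. pdy i \<alpha> x y * v $ i * (pdy j \<alpha> x y * v $ j)) = ?a * ?a"
      by (rule sum_product[symmetric])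
    finally show ?thesis
      by (simp add: inner_vec_def matrix_vector_mult_def sum_distrib_left)
  qed
  have aa: "\<alpha> x y * ?a = v \<bullet> (g x *v y)"
  proof -
    have "\<alpha> x y * ?a = (\<Sum>i\<in>UNIV. (\<alpha> x y * pdy i \<alpha> x y) * v $ i)"
      by (simp add: sum_distrib_left mult_ac)
    then show ?thesis unfolding alpha_pdy_alpha[OF xy]
      by (simp add: inner_vec_def flat_def mult.commute)
  qed
  define t where "t = ?a / \<alpha> x y"
  have at: "?a = t * \<alpha> x y" using alpha_pos[OF xy] by (simp add: t_def)
  have sym: "y \<bullet> (g x *v v) = v \<bullet> (g x *v y)"
    by (rule inner_symmetric_matrix[OF sym_g[OF xy(1)]])
  have "(v - t *\<^sub>R y) \<bullet> (g x *v (v - t *\<^sub>R y)) = v \<bullet> (g x *v v) - 2 * t * (v \<bullet> (g x *v y)) + t * t * q x y"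
    using sym by (simp add: q_def matrix_vector_mult_diff_distrib matrix_vector_mult_scaleR inner_diff_left inner_diff_right
        algebra_simps)
  also have "\<dots> = v \<bullet> (g x *v v) - ?a * ?a"
    unfolding aa[symmetric] alpha_square[OF xy, symmetric] at by simp
  finally have qv: "(v - t *\<^sub>R y) \<bullet> (g x *v (v - t *\<^sub>R y)) = \<alpha> x y * ?h" using ah by simp
  have h0: "?h \<ge> 0"
  proof -
    have "\<alpha> x y * ?h \<ge> 0"
      using pos_g[OF xy(1), of "v - t *\<^sub>R y"] unfolding qv[symmetric] by (cases "v - t *\<^sub>R y = 0") auto
    then show ?thesis using alpha_pos[OF xy] by (simp add: zero_le_mult_iff)
  qed
  have f: "?f > 0" by (rule F_pos[OF xy])
  have "?f * ?h \<ge> 0" using f h0 by simp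
  with 1 have "?s * ?s = 0" "?f * ?h = 0" using zero_le_square[of ?s] by linarith+
  then have s: "?s = 0" and h: "?h = 0" using f by auto
  have "v - t *\<^sub>R y = 0"
  proof (rule ccontr)
    assume "v - t *\<^sub>R y \<noteq> 0"
    from pos_g[OF xy(1) this] show False unfolding qv h by simp
  qed
  then have vt: "v = t *\<^sub>R y" by simp
  have "?s = ?a + \<beta> x v"
    by (simp add: distrib_right sum.distrib \<beta>_unfold)
  also have "\<dots> = t * ?f" unfolding at by (simp add: vt \<beta>_def algebra_simps)
  finally have "t = 0" using s f by simp
  then show ?thesis using vt by simp
qed

lemma det_fundamental_tensor:
  assumes xy: "x \<in> U" "y \<noteq> 0"
  shows "det (fundamental_tensor F x y) \<noteq> 0"
proof -
  have "\<exists>B. B ** fundamental_tensor F x y = mat 1"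
    unfolding matrix_left_invertible_ker using fundamental_tensor_kernel[OF xy] by blast
  then show ?thesis using invertible_left_inverse invertible_det_nz by blast
qed

lemma homogeneous_sq_F: "homogeneous 2 (sq F)"
proof -
  have "sqrt (t * (t * c)) = t * sqrt c" if "t > 0" for t c :: real
    using that by (simp add: real_sqrt_mult flip: mult.assoc)
  then show ?thesis
    unfolding homogeneous_def sq_def
    by (simp add: F matrix_vector_mult_scaleR power_mult_distrib flip: distrib_left)
qed

lemma smooth_spray_randers: "sm (spray F i)"
  by (rule smooth_spray_of_det[OF smooth_sq_F det_fundamental_tensor])

text \<open>The quadratic part \<open>\<alpha>\<^sup>2 - \<beta>\<^sup>2\<close> of the equation \<open>\<alpha>\<^sup>2 = (1 - \<beta>)\<^sup>2\<close> of the indicatrix \<open>F = 1\<close>.\<close>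

definition indicatrix_matrix :: "real^'n \<Rightarrow> real^'n^'n" where
  "indicatrix_matrix x = (\<chi> i j. g x $ i $ j - b x $ i * b x $ j)"

lemma indicatrix_matrix_quadratic: "y \<bullet> (indicatrix_matrix x *v y) = q x y - \<beta> x y * \<beta> x y"
proof -
  have "y \<bullet> (indicatrix_matrix x *v y) = q x y - (\<Sum>i\<in>UNIV. \<Sum>j\<in>UNIV. b x $ i * y $ i * (b x $ j * y $ j))"
    by (simp add: indicatrix_matrix_def q_def inner_vec_def matrix_vector_mult_def sum_distrib_left algebra_simps sum_subtractf)
  also have "(\<Sum>i\<in>UNIV. \<Sum>j\<in>UNIV. b x $ i * y $ i * (b x $ j * y $ j)) = \<beta> x y * \<beta> x y"
    unfolding \<beta>_unfold by (rule sum_product[symmetric])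
  finally show ?thesis .
qed

lemma indicatrix_matrix_sym: "x \<in> U \<Longrightarrow> transpose (indicatrix_matrix x) = indicatrix_matrix x"
  using sym_g[of x] by (simp add: indicatrix_matrix_def transpose_def vec_eq_iff mult.commute)

lemma abs_beta_less: "x \<in> U \<Longrightarrow> y \<noteq> 0 \<Longrightarrow> \<bar>\<beta> x y\<bar> < \<alpha> x y"
  using bound_b[of x y] by (simp add: \<alpha>_def \<beta>_def q_def)

lemma indicatrix_matrix_pos:
  assumes "x \<in> U" "y \<noteq> 0"
  shows "y \<bullet> (indicatrix_matrix x *v y) > 0"
proof -
  have "\<bar>\<beta> x y\<bar> * \<bar>\<beta> x y\<bar> < \<alpha> x y * \<alpha> x y"
    using abs_beta_less[OF assms] by (intro mult_strict_mono') auto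
  then show ?thesis unfolding indicatrix_matrix_quadratic alpha_square[OF assms] by (simp add: abs_mult_self_eq)
qed

text \<open>Squaring \<open>\<alpha> < 1 - \<beta>\<close> is reversible: if \<open>1 - \<beta>\<close> were negative, \<open>\<alpha>\<^sup>2 < (1 - \<beta>)\<^sup>2\<close> would give \<open>\<alpha> < \<beta> - 1\<close>,
against \<open>|\<beta>| < \<alpha>\<close>.\<close>

lemma unit_ball_eq_ellipsoid:
  assumes x: "x \<in> U"
  shows "{y. F x y < 1} = {y. y \<bullet> (indicatrix_matrix x *v y) + 2 * (b x \<bullet> y) < 1}"
proof (intro Collect_cong)
  fix y
  show "F x y < 1 \<longleftrightarrow> y \<bullet> (indicatrix_matrix x *v y) + 2 * (b x \<bullet> y) < 1"
  proof (cases "y = 0")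
    case True
    then show ?thesis using F[OF x, of 0] by simp
  next
    case False
    note xy = x False
    have "F x y < 1 \<longleftrightarrow> \<alpha> x y < 1 - \<beta> x y"
      using F[OF x, of y] by (auto simp: \<alpha>_def \<beta>_def q_def)
    also have "\<dots> \<longleftrightarrow> \<alpha> x y * \<alpha> x y < (1 - \<beta> x y) * (1 - \<beta> x y)"
    proof
      assume "\<alpha> x y < 1 - \<beta> x y"
      then show "\<alpha> x y * \<alpha> x y < (1 - \<beta> x y) * (1 - \<beta> x y)"
        using alpha_pos[OF xy] by (intro mult_strict_mono') auto
    next
      assume "\<alpha> x y * \<alpha> x y < (1 - \<beta> x y) * (1 - \<beta> x y)"
      then have "(\<alpha> x y)\<^sup>2 < \<bar>1 - \<beta> x y\<bar>\<^sup>2" by (simp add: power2_eq_square)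
      then have "\<alpha> x y < \<bar>1 - \<beta> x y\<bar>" using power2_less_imp_less by fastforce
      then show "\<alpha> x y < 1 - \<beta> x y" using abs_beta_less[OF xy] by linarith
    qed
    also have "\<dots> \<longleftrightarrow> y \<bullet> (indicatrix_matrix x *v y) + 2 * (b x \<bullet> y) < 1"
      unfolding alpha_square[OF xy] indicatrix_matrix_quadratic by (auto simp: algebra_simps \<beta>_def)
    finally show ?thesis .
  qed
qed

lemma smooth_ln_BH_density: "smooth_on U (\<lambda>x. ln (BH_density F x))"
proof -
  let ?D = "\<lambda>x. index_matrix (indicatrix_matrix x)" and ?b = "\<lambda>x. index_vector (b x)"
  define c where "c x = matrix_inv (?D x) *v ?b x" for x
  \<comment> \<open>The volumes of the two Euclidean unit balls are positive constants, so they do not affect smoothness.\<close>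
  define V where "V = measure lborel (ball (0::real^'n) 1)"
  define V' where "V' = measure lborel (ball (0::real^('n index)) 1)"
  have V: "V > 0" "V' > 0" unfolding V_def V'_def by (simp_all add: content_ball)
  have det: "det (?D x) > 0" if "x \<in> U" for x
    using index_matrix_posdef[OF indicatrix_matrix_sym[OF that] indicatrix_matrix_pos[OF that]] by (intro posdef_det_pos) auto
  have c: "?D x *v c x = ?b x" if "x \<in> U" for x
    using det[OF that] by (simp add: c_def matrix_vector_mul_assoc matrix_inv_works invertible_det_nz)
  have bc: "1 + ?b x \<bullet> c x > 0" if "x \<in> U" for x
  proof -
    have "?b x \<bullet> c x \<ge> 0"
      using index_matrix_posdef(2)[OF indicatrix_matrix_sym[OF that] indicatrix_matrix_pos[OF that], of "c x"] c[OF that]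
      by (cases "c x = 0") (auto simp: inner_commute less_imp_le)
    then show ?thesis by simp
  qed
  have D: "smooth_on U (\<lambda>x. ?D x $ i $ j)" for i j
  proof -
    have "smooth_on U (\<lambda>x. g x $ enum_index i $ enum_index j + (- 1) * (b x $ enum_index i * b x $ enum_index j))"
      by (intro smooth_on_add smooth_on_mult smooth_on_const smooth_on_vec_nth open_U smooth_g smooth_b)
    then show ?thesis by (simp add: index_matrix_def indicatrix_matrix_def)
  qed
  have "smooth_on U (\<lambda>x. 1 + (\<Sum>i\<in>UNIV. b x $ enum_index i * (\<Sum>j\<in>UNIV. matrix_inv (?D x) $ i $ j * b x $ enum_index j)))"
    using det
    by (intro smooth_on_add smooth_on_sum smooth_on_mult smooth_on_const smooth_on_vec_nth
        smooth_on_matrix_inv open_U smooth_b D) force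
  then have r: "smooth_on U (\<lambda>x. 1 + ?b x \<bullet> c x)"
    by (simp add: c_def inner_vec_def matrix_vector_mult_def index_vector_def)
  have vol: "measure lborel {y. F x y < 1} = sqrt (1 + ?b x \<bullet> c x) ^ CARD('n index) / sqrt (det (?D x)) * V'"
    if "x \<in> U" for x
    unfolding unit_ball_eq_ellipsoid[OF that] V'_def
    by (rule ellipsoid_volume_index[OF indicatrix_matrix_sym[OF that] indicatrix_matrix_pos[OF that] c[OF that]])
  have "smooth_on U (\<lambda>x. ln (V / (sqrt (1 + ?b x \<bullet> c x) ^ CARD('n index) / sqrt (det (?D x)) * V')))"
  proof (intro smooth_on_ln smooth_on_divide smooth_on_mult smooth_on_const smooth_on_power smooth_on_sqrt
      smooth_on_det D r open_U)
    fix x assume x: "x \<in> U"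
    show "det (?D x) > 0" "1 + ?b x \<bullet> c x > 0" using det[OF x] bc[OF x] .
    show "sqrt (det (?D x)) \<noteq> 0" using det[OF x] by simp
    have vol_pos: "sqrt (1 + ?b x \<bullet> c x) ^ CARD('n index) / sqrt (det (?D x)) * V' > 0"
      using det[OF x] bc[OF x] V by simp
    then show "sqrt (1 + ?b x \<bullet> c x) ^ CARD('n index) / sqrt (det (?D x)) * V' \<noteq> 0"
      by (rule less_imp_neq[symmetric])
    show "V / (sqrt (1 + ?b x \<bullet> c x) ^ CARD('n index) / sqrt (det (?D x)) * V') > 0"
      by (rule divide_pos_pos[OF V(1) vol_pos])
  qed
  then show ?thesis
    by (rule smooth_on_cong[OF _ open_U]) (simp add: BH_density_def vol V_def)
qed

lemma projective_field_on_randers: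
  assumes "smooth_on U W"
    and "\<And>x y i. x \<in> U \<Longrightarrow> y \<noteq> 0 \<Longrightarrow> Lie_spray W (spray F) i x y = P x y * y $ i"
  shows "projective_field_on U F P W"
  using smooth_spray_randers homogeneous_spray[OF smooth_sq_F homogeneous_sq_F] assms(1) smooth_ln_BH_density
    assms(2) by (rule projective_field_on_of_spray)

end

section \<open>Charts and tangent vectors\<close>

locale atlas =
  fixes M :: "'m topology" and A :: "('m, 'n::finite) chart set"
  assumes atlas: "smooth_atlas M A"
begin

lemma chart:
  assumes "c \<in> A"
  shows "openin M (fst c)" "open (chart_image c)"
    "homeomorphic_map (subtopology M (fst c)) (top_of_set (chart_image c)) (snd c)"
  using atlas assms by (auto simp: smooth_atlas_def)

lemma topspace_chart: "c \<in> A \<Longrightarrow> topspace (subtopology M (fst c)) = fst c"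
  using openin_subset[OF chart(1), of c] by (simp add: inf.absorb2)

lemma inj_chart: "c \<in> A \<Longrightarrow> inj_on (snd c) (fst c)"
  using homeomorphic_imp_injective_map[OF chart(3)] topspace_chart by metis

lemma chart_inv_chart: "c \<in> A \<Longrightarrow> p \<in> fst c \<Longrightarrow> chart_inv c (snd c p) = p"
  unfolding chart_inv_def by (rule inv_into_f_f[OF inj_chart])

lemma
  assumes "x \<in> chart_image c"
  shows chart_chart_inv: "snd c (chart_inv c x) = x" and chart_inv_mem: "chart_inv c x \<in> fst c"
  using assms unfolding chart_inv_def chart_image_def by (auto intro: f_inv_into_f inv_into_into)

lemma chart_mem: "p \<in> fst c \<Longrightarrow> snd c p \<in> chart_image c"
  by (simp add: chart_image_def)

lemma open_overlap:
  assumes "c \<in> A" "d \<in> A"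
  shows "open (snd c ` (fst c \<inter> fst d))"
proof -
  have "openin (subtopology M (fst c)) (fst c \<inter> fst d)"
    using chart(1)[OF assms(2)] openin_subtopology_Int2 by blast
  then have "openin (top_of_set (chart_image c)) (snd c ` (fst c \<inter> fst d))"
    using homeomorphic_map_openness[OF chart(3)[OF assms(1)], of "fst c \<inter> fst d"] topspace_chart[OF assms(1)]
    by auto
  then show ?thesis using chart(2)[OF assms(1)] openin_open_trans by blast
qed

lemma transition_has_derivative:
  assumes "c \<in> A" "d \<in> A" "p \<in> fst c" "p \<in> fst d"
  shows "(transition c d has_derivative frechet_derivative (transition c d) (at (snd c p))) (at (snd c p))"
proof -
  have "smooth_on (snd c ` (fst c \<inter> fst d)) (transition c d)"
    using atlas assms by (simp add: smooth_atlas_def)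
  then show ?thesis by (rule smooth_on_has_derivative) (use assms in auto)
qed

lemma transition_self:
  assumes "c \<in> A" "p \<in> fst c"
  shows "frechet_derivative (transition c c) (at (snd c p)) = (\<lambda>y. y)"
proof -
  have "(transition c c has_derivative (\<lambda>y. y)) (at (snd c p))"
    by (rule has_derivative_transform_within_open[OF has_derivative_ident chart(2)[OF assms(1)] chart_mem[OF assms(2)]])
       (simp add: transition_def chart_chart_inv)
  then show ?thesis by (rule frechet_derivative_at[symmetric])
qed

text \<open>The chain rule for transition maps.  It is what makes the coordinates prescribed in one chart extend consistently to all charts.\<close>

lemma transition_comp:
  assumes "c \<in> A" "d \<in> A" "e \<in> A" "p \<in> fst c" "p \<in> fst d" "p \<in> fst e"
  shows "frechet_derivative (transition c e) (at (snd c p)) v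
    = frechet_derivative (transition d e) (at (snd d p)) (frechet_derivative (transition c d) (at (snd c p)) v)"
proof -
  have val: "transition c d (snd c p) = snd d p"
    using assms by (simp add: transition_def chart_inv_chart)
  have "(transition d e \<circ> transition c d has_derivative
      frechet_derivative (transition d e) (at (snd d p)) \<circ> frechet_derivative (transition c d) (at (snd c p)))
      (at (snd c p))"
    using transition_has_derivative[of d e p] transition_has_derivative[of c d p] assms
    by (intro diff_chain_at) (simp_all add: val)
  then have "(transition c e has_derivative
      frechet_derivative (transition d e) (at (snd d p)) \<circ> frechet_derivative (transition c d) (at (snd c p)))
      (at (snd c p))"
  proof (rule has_derivative_transform_within_open[OF _ open_overlap[OF assms(1,2)]])
    fix z assume "z \<in> snd c ` (fst c \<inter> fst d)"
    then show "(transition d e \<circ> transition c d) z = transition c e z"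
      using assms by (auto simp: transition_def chart_inv_chart)
  qed (use assms in auto)
  from frechet_derivative_at[OF this, symmetric] show ?thesis by simp
qed

lemma tangent_space_eqI:
  assumes "v \<in> tangent_space A p" "w \<in> tangent_space A p" "c \<in> A" "p \<in> fst c" "v c = w c"
  shows "v = w"
proof
  fix d
  show "v d = w d"
  proof (cases "d \<in> A \<and> p \<in> fst d")
    case True
    then have "u d = frechet_derivative (transition c d) (at (snd c p)) (u c)" if "u \<in> tangent_space A p" for u
      using that assms(3,4) unfolding tangent_space_def by blast
    from this[OF assms(1)] this[OF assms(2)] show ?thesis by (simp add: assms(5))
  next
    case False
    then have "u d = 0" if "u \<in> tangent_space A p" for u
      using that unfolding tangent_space_def by blast
    from this[OF assms(1)] this[OF assms(2)] show ?thesis by simp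
  qed
qed

lemma tangent_space_zero: "(\<lambda>_. 0) \<in> tangent_space A p"
  unfolding tangent_space_def
proof (intro CollectI conjI ballI allI impI)
  fix c d assume "c \<in> A" "d \<in> A" "p \<in> fst c" "p \<in> fst d"
  from linear_0[OF has_derivative_linear[OF transition_has_derivative[OF this]]]
  show "0 = frechet_derivative (transition c d) (at (snd c p)) 0" by simp
qed simp

text \<open>A tangent vector is determined by its coordinates in one chart, and the Jacobians of the transition maps out of that
chart provide one with prescribed coordinates.\<close>

lemma coord_vec_works:
  assumes c: "c \<in> A" and x: "x \<in> chart_image c"
  shows "coord_vec A c x y \<in> tangent_space A (chart_inv c x)" "coord_vec A c x y c = y"
proof -
  let ?p = "chart_inv c x"
  have p: "?p \<in> fst c" and cp: "snd c ?p = x" using chart_inv_mem[OF x] chart_chart_inv[OF x] .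
  define v where "v d = (if d \<in> A \<and> ?p \<in> fst d then frechet_derivative (transition c d) (at x) y else 0)" for d
  have "v \<in> tangent_space A ?p"
    unfolding tangent_space_def
  proof (intro CollectI conjI ballI allI impI)
    fix d e assume "d \<in> A" "e \<in> A" "?p \<in> fst d" "?p \<in> fst e"
    with transition_comp[OF c this(1,2) p this(3,4), of y]
    show "v e = frechet_derivative (transition d e) (at (snd d ?p)) (v d)"
      by (simp add: v_def cp)
  next
    fix d assume "\<not> (d \<in> A \<and> ?p \<in> fst d)"
    then show "v d = 0" unfolding v_def by (rule if_not_P)
  qed
  moreover have "v c = y" using transition_self[OF c p] c p by (simp add: v_def cp)
  ultimately have "\<exists>!v. v \<in> tangent_space A ?p \<and> v c = y"
    by (intro ex1I[of _ v]) (auto intro: tangent_space_eqI[OF _ _ c p])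
  from theI'[OF this] show "coord_vec A c x y \<in> tangent_space A ?p" "coord_vec A c x y c = y"
    unfolding coord_vec_def by auto
qed

text \<open>The strict bound \<open>|\<beta>| < \<alpha>\<close> in coordinates follows from the assumption on the supremum once the set of quotients is
known to be bounded, since the supremum of an unbounded set of reals carries no information.\<close>

lemma randers_chart_of_randers_metric:
  assumes randers: "randers_metric M A a \<beta> F" and c: "c \<in> A"
  shows "\<exists>g b. randers_chart (chart_image c) (local_fun A c F) g b"
proof -
  have "riemannian_metric A a" "one_form A \<beta>"
    using randers by (simp_all add: randers_metric_def)
  from \<open>riemannian_metric A a\<close> c obtain g :: "real^'n \<Rightarrow> real^'n^'n" where
    metric: "smooth_on (chart_image c) g \<and>
      (\<forall>x\<in>chart_image c. transpose (g x) = g x \<and> (\<forall>y. y \<noteq> 0 \<longrightarrow> y \<bullet> (g x *v y) > 0)) \<and>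
      (\<forall>p\<in>fst c. \<forall>v\<in>tangent_space A p. \<forall>w\<in>tangent_space A p.
         a p v w = (\<Sum>i\<in>UNIV. \<Sum>j\<in>UNIV. g (snd c p) $ i $ j * v c $ i * w c $ j))"
    unfolding riemannian_metric_def by blast
  have g: "smooth_on (chart_image c) g"
    "\<And>x. x \<in> chart_image c \<Longrightarrow> transpose (g x) = g x"
    "\<And>x y. x \<in> chart_image c \<Longrightarrow> y \<noteq> 0 \<Longrightarrow> y \<bullet> (g x *v y) > 0"
    "\<And>p v w. p \<in> fst c \<Longrightarrow> v \<in> tangent_space A p \<Longrightarrow> w \<in> tangent_space A p \<Longrightarrow>
      a p v w = (\<Sum>i\<in>UNIV. \<Sum>j\<in>UNIV. g (snd c p) $ i $ j * v c $ i * w c $ j)"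
    using metric by simp_all
  from \<open>one_form A \<beta>\<close> c obtain b :: "real^'n \<Rightarrow> real^'n" where b: "smooth_on (chart_image c) b"
    "\<And>p v. p \<in> fst c \<Longrightarrow> v \<in> tangent_space A p \<Longrightarrow> \<beta> p v = (\<Sum>i\<in>UNIV. b (snd c p) $ i * v c $ i)"
    unfolding one_form_def by blast
  have top: "p \<in> topspace M" if "p \<in> fst c" for p
    using openin_subset[OF chart(1)[OF c]] that by auto
  have av: "a p v v = v c \<bullet> (g (snd c p) *v v c)" if "p \<in> fst c" "v \<in> tangent_space A p" for p v
    unfolding g(4)[OF that that(2)] by (simp add: inner_vec_def matrix_vector_mult_def sum_distrib_left mult_ac)
  have bv: "\<beta> p v = b (snd c p) \<bullet> v c" if "p \<in> fst c" "v \<in> tangent_space A p" for p v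
    unfolding b(2)[OF that] by (simp add: inner_vec_def)
  have "randers_chart (chart_image c) (local_fun A c F) g b"
  proof
    fix x y assume x: "x \<in> chart_image c"
    let ?p = "chart_inv c x" and ?v = "coord_vec A c x y"
    have p: "?p \<in> fst c" and cp: "snd c ?p = x" using chart_inv_mem[OF x] chart_chart_inv[OF x] .
    note v = coord_vec_works[OF c x, of y]
    have F: "F ?p ?v = sqrt (a ?p ?v ?v) + \<beta> ?p ?v"
      using randers top[OF p] v(1) unfolding randers_metric_def by blast
    show "local_fun A c F x y = sqrt (y \<bullet> (g x *v y)) + b x \<bullet> y"
      unfolding local_fun_def F av[OF p v(1)] bv[OF p v(1)] cp v(2) by simp
    show "\<bar>b x \<bullet> y\<bar> < sqrt (y \<bullet> (g x *v y))" if y: "y \<noteq> 0"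
    proof -
      let ?r = "\<lambda>v. \<bar>\<beta> ?p v\<bar> / sqrt (a ?p v v)"
      obtain B where B: "\<And>y. \<bar>b x \<bullet> y\<bar> \<le> B * sqrt (y \<bullet> (g x *v y))"
        using posdef_linear_bound[OF g(2)[OF x] g(3)[OF x], of "b x"] by blast
      have bdd: "bdd_above (?r ` (tangent_space A ?p - {\<lambda>_. 0}))"
      proof (rule bdd_aboveI2)
        fix v assume "v \<in> tangent_space A ?p - {\<lambda>_. 0}"
        then have v: "v \<in> tangent_space A ?p" "v \<noteq> (\<lambda>_. 0)" by auto
        then have "v c \<noteq> 0" using tangent_space_eqI[OF v(1) tangent_space_zero c p] by auto
        then have "sqrt (v c \<bullet> (g x *v v c)) > 0" using g(3)[OF x] by simp
        then show "?r v \<le> B"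
          using B[of "v c"] by (simp add: av[OF p v(1)] bv[OF p v(1)] cp divide_le_eq)
      qed
      have "?v \<noteq> (\<lambda>_. 0)" using v(2) y by auto
      then have "?r ?v \<le> one_form_norm A a \<beta> ?p"
        unfolding one_form_norm_def using v(1) by (intro cSUP_upper bdd) auto
      also have "\<dots> < 1" using randers top[OF p] unfolding randers_metric_def by blast
      finally show ?thesis
        using g(3)[OF x y] by (simp add: av[OF p v(1)] bv[OF p v(1)] cp v(2) divide_less_eq)
    qed
  qed (use g b chart(2)[OF c] in auto)
  then show ?thesis by blast
qed

end

theorem theorem1p1:
  fixes M :: "'m topology"
    and A :: "('m, 'n::finite) chart set"
    and a :: "'m \<Rightarrow> ('m, 'n) tvec \<Rightarrow> ('m, 'n) tvec \<Rightarrow> real"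
    and \<beta> F :: "'m \<Rightarrow> ('m, 'n) tvec \<Rightarrow> real"
    and V :: "'m \<Rightarrow> ('m, 'n) tvec"
  assumes "smooth_manifold M A"
    and "connected_space M"
    and "randers_metric M A a \<beta> F"
    and "\<exists>p\<in>topspace M. \<exists>v\<in>tangent_space A p. \<beta> p v \<noteq> 0"
    and "smooth_vector_field M A V"
    and "projective_vector_field A F V"
  shows "(C_projective A F V \<longleftrightarrow> Lie_Sigma_vanishes A F V) \<and>
         (Lie_Sigma_vanishes A F V \<longleftrightarrow> Lie_Xi_vanishes A F V)"
proof -
  interpret atlas M A using assms(1) by unfold_locales (simp add: smooth_manifold_def)
  have local: "projective_field_on (chart_image c) (local_fun A c F) (local_fun A c P) (local_vf c V)"
    if P: "projective_factor A F V P" and c: "c \<in> A" for P c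
  proof -
    obtain g b where "randers_chart (chart_image c) (local_fun A c F) g b"
      using randers_chart_of_randers_metric[OF assms(3) c] by blast
    moreover have "smooth_on (chart_image c) (local_vf c V)"
      using assms(5) c by (simp add: smooth_vector_field_def)
    ultimately show ?thesis
      using P c by (intro randers_chart.projective_field_on_randers) (auto simp: projective_factor_def)
  qed
  note equiv = projective_field_on.local_equivalence[OF local]
  have curl: "(\<forall>c\<in>A. \<forall>x\<in>chart_image c. \<forall>y. y \<noteq> 0 \<longrightarrow>
          (\<forall>i j. hder_covec (local_fun A c F) (\<lambda>r. pdy r (local_fun A c P)) i j x y
               = hder_covec (local_fun A c F) (\<lambda>r. pdy r (local_fun A c P)) j i x y))
      \<longleftrightarrow> Lie_Sigma_vanishes A F V" if "projective_factor A F V P" for P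
    unfolding Lie_Sigma_vanishes_def by (rule ball_cong[OF refl equiv(1)[OF that]])
  obtain P where P: "projective_factor A F V P"
    using assms(6) unfolding projective_vector_field_def by blast
  have "C_projective A F V \<longleftrightarrow> Lie_Sigma_vanishes A F V"
    unfolding C_projective_def using curl P by blast
  moreover have "Lie_Sigma_vanishes A F V \<longleftrightarrow> Lie_Xi_vanishes A F V"
    unfolding Lie_Sigma_vanishes_def Lie_Xi_vanishes_def by (rule ball_cong[OF refl equiv(2)[OF P]])
  ultimately show ?thesis by blast
qed

end
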